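(* Let $1<p,q<\infty$, let $B(\ell_p,\ell_q)$ be the Banach space of bounded linear operators from $\ell_p$ to $\ell_q$ with the operator norm, and let $T\in B(\ell_p,\ell_q)$ with $\|T\|=1$. Then the following are equivalent: (i) The norm of $B(\ell_p,\ell_q)$ is Fréchet differentiable at $T$. (ii) $\|T\|_e<1$, and if $\|Tx_1\|=\|Tx_2\|=1$ for $x_1,x_2\in B_{\ell_p}$, then $x_1=\alpha x_2$ for some $\alpha\in\mathbb{F}$ with $|\alpha|=1$. Consequently, the norm of $B(\ell_p,\ell_q)$ is Fréchet differentiable at $T$ if and only if the norm of $B(\ell_p,\ell_q)$ is Gateaux differentiable at $T$.
   Context: Scalars are $\mathbb{F}\in\{\mathbb{R},\mathbb{C}\}$. For a Banach space $X$, $S_X$ and $B_X$ denote its unit sphere and closed unit ball. The norm of $X$ is Fréchet differentiable at $u\in S_X$ if there is a bounded linear functional $f\in X^*$ such that $\lim_{t\to0}\frac{\|u+tx\|-1}{t}=\operatorname{Re}f(x)$ uniformly for $x\in B_X$ ($t$ real); it is Gateaux differentiable at $u$ if there is such an $f$ for which the limit holds at each $x\in B_X$, without requiring uniformity. The essential norm $\|T\|_e$ of a bounded linear operator $T:X\to Y$ is the operator-norm distance from $T$ to the space of compact operators from $X$ to $Y$. *)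

theory Defs
  imports "HOL-Analysis.Analysis" "HOL-Library.Function_Algebras"
begin

text \<open>
  The exponent of \<open>\<ell>\<^sub>p\<close> is a term, so \<open>\<ell>\<^sub>p\<close> and \<open>B(\<ell>\<^sub>p, \<ell>\<^sub>q)\<close> cannot be types here. A normed space
  over the scalars \<open>'a\<close> is given by a carrier inside an additive group type \<open>'v\<close>, a scalar
  multiplication and a norm; addition is that of \<open>'v\<close>, which is pointwise on function types
  (\<^theory>\<open>HOL-Library.Function_Algebras\<close>). The record states no axioms: it is only used for the
  concrete spaces \<open>scalars\<close>, \<open>lp p\<close> and \<open>bops (lp p) (lp q)\<close> below.
\<close>

record ('a, 'v) nspace =
  vecs :: "'v set"
  smul :: "'a \<Rightarrow> 'v \<Rightarrow> 'v"
  nrm :: "'v \<Rightarrow> real"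

definition unit_ball :: "('a, 'v) nspace \<Rightarrow> 'v set" where
  "unit_ball X = {x \<in> vecs X. nrm X x \<le> 1}"

definition unit_sphere :: "('a, 'v) nspace \<Rightarrow> 'v set" where
  "unit_sphere X = {x \<in> vecs X. nrm X x = 1}"

definition scalars :: "('a::real_normed_field, 'a) nspace" where
  "scalars = \<lparr>vecs = UNIV, smul = (*), nrm = norm\<rparr>"

definition lp :: "real \<Rightarrow> ('a::real_normed_field, nat \<Rightarrow> 'a) nspace" where
  "lp p = \<lparr>vecs = {x. summable (\<lambda>n. norm (x n) powr p)},
           smul = (\<lambda>c x n. c * x n),
           nrm = (\<lambda>x. (\<Sum>n. norm (x n) powr p) powr (1 / p))\<rparr>"

text \<open>
  The space of bounded linear operators from \<open>X\<close> to \<open>Y\<close> with the operator norm. Operators are set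
  to \<open>0\<close> outside the carrier of \<open>X\<close>, so that each operator is represented by exactly one function
  and the carrier is closed under the pointwise operations.
\<close>

definition bops ::
  "('a, 'v::ab_group_add) nspace \<Rightarrow> ('a, 'w::ab_group_add) nspace \<Rightarrow> ('a, 'v \<Rightarrow> 'w) nspace" where
  "bops X Y =
    \<lparr>vecs = {A. (\<forall>x\<in>vecs X. A x \<in> vecs Y) \<and>
                (\<forall>x\<in>vecs X. \<forall>y\<in>vecs X. A (x + y) = A x + A y) \<and>
                (\<forall>c. \<forall>x\<in>vecs X. A (smul X c x) = smul Y c (A x)) \<and>
                (\<exists>C. \<forall>x\<in>vecs X. nrm Y (A x) \<le> C * nrm X x) \<and>
                (\<forall>x. x \<notin> vecs X \<longrightarrow> A x = 0)},
     smul = (\<lambda>c A x. smul Y c (A x)),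
     nrm = (\<lambda>A. SUP x\<in>unit_ball X. nrm Y (A x))\<rparr>"

abbreviation dual ::
  "('a::real_normed_field, 'v::ab_group_add) nspace \<Rightarrow> ('a, 'v \<Rightarrow> 'a) nspace" where
  "dual X \<equiv> bops X scalars"

definition norm_topology :: "('a, 'v::ab_group_add) nspace \<Rightarrow> 'v topology" where
  "norm_topology X = Metric_space.mtopology (vecs X) (\<lambda>x y. nrm X (x - y))"

definition compact_ops ::
  "('a, 'v::ab_group_add) nspace \<Rightarrow> ('a, 'w::ab_group_add) nspace \<Rightarrow> ('v \<Rightarrow> 'w) set" where
  "compact_ops X Y =
    {K \<in> vecs (bops X Y).
       compactin (norm_topology Y) (norm_topology Y closure_of (K ` unit_ball X))}"

definition ess_norm ::
  "('a, 'v::ab_group_add) nspace \<Rightarrow> ('a, 'w::ab_group_add) nspace \<Rightarrow> ('v \<Rightarrow> 'w) \<Rightarrow> real" where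
  "ess_norm X Y A = (INF K\<in>compact_ops X Y. nrm (bops X Y) (A - K))"

text \<open>
  The scalar type is meant to be \<^typ>\<open>real\<close> or \<^typ>\<open>complex\<close>. In both cases \<open>z \<bullet> 1\<close> is the real
  part of \<open>z\<close>.
\<close>

definition frechet_differentiable_norm ::
  "('a::{real_normed_field, real_inner}, 'v::ab_group_add) nspace \<Rightarrow> 'v \<Rightarrow> bool" where
  "frechet_differentiable_norm X u \<longleftrightarrow> u \<in> unit_sphere X \<and>
    (\<exists>f\<in>vecs (dual X).
       uniform_limit (unit_ball X)
         (\<lambda>t x. (nrm X (u + smul X (of_real t) x) - 1) / t) (\<lambda>x. f x \<bullet> 1) (at (0::real)))"

definition gateaux_differentiable_norm ::
  "('a::{real_normed_field, real_inner}, 'v::ab_group_add) nspace \<Rightarrow> 'v \<Rightarrow> bool" where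
  "gateaux_differentiable_norm X u \<longleftrightarrow> u \<in> unit_sphere X \<and>
    (\<exists>f\<in>vecs (dual X). \<forall>x\<in>unit_ball X.
       ((\<lambda>t. (nrm X (u + smul X (of_real t) x) - 1) / t) \<longlongrightarrow> f x \<bullet> 1) (at (0::real)))"

end

theory Submission
  imports Defs
begin

text \<open>
  Why the theorem holds. Write \<open>\<parallel>T\<parallel> = 1\<close> and let \<open>R\<^sub>n\<close> be the projection that deletes the first \<open>n\<close>
  coordinates. Since \<open>T - R\<^sub>n T\<close> has finite rank and \<open>\<parallel>R\<^sub>n K\<parallel> \<rightarrow> 0\<close> for compact \<open>K\<close>, the condition
  \<open>\<parallel>T\<parallel>\<^sub>e < 1\<close> means that \<open>\<parallel>R\<^sub>n T\<parallel> < 1\<close> for some \<open>n\<close> (\<open>ess_norm_less_iff\<close>).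

  Gateaux differentiability implies (ii), because a failure of (ii) produces an operator \<open>S\<close> with
  \<open>\<parallel>T + t S\<parallel> \<ge> max 1 \<bar>1 + t\<bar>\<close> for all real \<open>t\<close>, and then \<open>t \<mapsto> \<parallel>T + t S\<parallel>\<close> has a kink at \<open>0\<close>
  (\<open>not_gateaux_if_kink\<close>). If \<open>T\<close> attains its norm at two vectors that are not proportional, \<open>S\<close> is a
  rank-one operator that agrees with \<open>T\<close> at the first and vanishes at the second
  (\<open>gateaux_imp_unique_maximizer\<close>). If \<open>\<parallel>T\<parallel>\<^sub>e = 1\<close>, a gliding hump gives vectors whose images are almost
  of norm \<open>1\<close> on disjoint blocks of coordinates; \<open>S\<close> is \<open>T\<close> followed by the projection onto
  every second block (\<open>splitting_if_ess_norm_ge_1\<close>).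

  Conversely, assume (ii). Every sequence in the unit ball with \<open>\<parallel>T x\<^sub>n\<parallel> \<rightarrow> 1\<close> has a norm convergent
  subsequence (\<open>maximizing_sequence_converges\<close>). Indeed, write a coordinatewise convergent
  subsequence as \<open>z + w\<^sub>n\<close> with \<open>w\<^sub>n\<close> tending to \<open>0\<close> in each coordinate; as \<open>1 < p\<close>, also \<open>T w\<^sub>n\<close> tends to
  \<open>0\<close> in each coordinate. In the limit the \<open>p\<close>-th powers of the norms of \<open>z\<close> and \<open>w\<^sub>n\<close> add up, and so do
  the \<open>q\<close>-th powers of the norms of \<open>T z\<close> and \<open>T w\<^sub>n\<close> (\<open>brezis_lieb\<close>). For \<open>p \<le> q\<close>, some mass left in
  \<open>w\<^sub>n\<close> would cost too much, because \<open>T\<close> shrinks \<open>w\<^sub>n\<close> asymptotically by a factor less than \<open>1\<close>; for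
  \<open>q < p\<close> one has \<open>T w\<^sub>n \<rightarrow> 0\<close> in norm, which is the content of Pitt's theorem (\<open>pitt_limit\<close>).

  Hence \<open>T\<close> attains its norm at some \<open>z\<close>, and by uniqueness every almost maximizing vector is close to
  a unimodular multiple of \<open>z\<close>. So for small \<open>t\<close> the norm of \<open>T + t A\<close> is determined near \<open>z\<close>,
  where it is controlled by the norm of \<open>\<ell>\<^sub>q\<close> near \<open>T z\<close>. As that norm is Frechet
  differentiable at \<open>T z\<close> (\<open>lq_norm_smooth_upper\<close>), a convexity argument transfers the expansion to
  the operator norm, uniformly in \<open>A\<close> (\<open>norm_expansion\<close>).

  Both scalar fields are treated at once: they are normed fields that are Euclidean spaces, and the
  real part of \<open>z\<close> is \<open>z \<bullet> 1\<close>.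
\<close>

section \<open>The sequence spaces\<close>

text \<open>In these names and in those for operators, \<open>c\<close> stands for the carrier and \<open>n\<close> for the norm.\<close>

abbreviation lpc :: "real \<Rightarrow> (nat \<Rightarrow> 'a::real_normed_field) set" where
  "lpc p \<equiv> vecs (lp p)"

abbreviation lpn :: "real \<Rightarrow> (nat \<Rightarrow> 'a::real_normed_field) \<Rightarrow> real" where
  "lpn p \<equiv> nrm (lp p)"

lemma lpc_iff: "x \<in> lpc p \<longleftrightarrow> summable (\<lambda>n. norm (x n) powr p)"
  by (simp add: lp_def)

lemma lpn_eq: "lpn p x = (\<Sum>n. norm (x n) powr p) powr (1 / p)"
  by (simp add: lp_def)

lemma smul_lp [simp]: "smul (lp p) c x = (\<lambda>n. c * x n)"
  by (simp add: lp_def)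

lemma lpn_nonneg [simp]: "0 \<le> lpn p x"
  by (simp add: lpn_eq)

lemma lpn_powr:
  assumes "0 < p" "x \<in> lpc p"
  shows "lpn p x powr p = (\<Sum>n. norm (x n) powr p)"
  using assms by (simp add: lpn_eq powr_powr lpc_iff suminf_nonneg)

lemma powr_le_powr_cancel:
  fixes a b p :: real
  assumes "0 < p" "0 \<le> b" "a powr p \<le> b powr p"
  shows "a \<le> b"
  using assms powr_less_mono2[of p b a] by fastforce

text \<open>
  Bounding finite partial sums settles membership and norm at the same time. This form is used both
  for sums of two vectors and for coordinatewise limits, where it plays the role of Fatou's lemma.
\<close>

lemma lpc_lpn_le_iff:
  assumes "0 < p" "0 \<le> C"
  shows "x \<in> lpc p \<and> lpn p x \<le> C \<longleftrightarrow> (\<forall>n. (\<Sum>i<n. norm (x i) powr p) \<le> C powr p)"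
proof
  assume x: "x \<in> lpc p \<and> lpn p x \<le> C"
  show "\<forall>n. (\<Sum>i<n. norm (x i) powr p) \<le> C powr p"
  proof
    fix n
    have "(\<Sum>i<n. norm (x i) powr p) \<le> (\<Sum>i. norm (x i) powr p)"
      using x by (intro sum_le_suminf) (auto simp: lpc_iff)
    also have "\<dots> = lpn p x powr p"
      using x assms by (simp add: lpn_powr)
    also have "\<dots> \<le> C powr p"
      using x assms by (intro powr_mono2) auto
    finally show "(\<Sum>i<n. norm (x i) powr p) \<le> C powr p" .
  qed
next
  assume le: "\<forall>n. (\<Sum>i<n. norm (x i) powr p) \<le> C powr p"
  then have x: "x \<in> lpc p"
    unfolding lpc_iff by (intro summableI_nonneg_bounded[where x = "C powr p"]) auto
  have "lpn p x powr p \<le> C powr p"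
    using le x assms by (simp add: lpn_powr suminf_le_const lpc_iff)
  then show "x \<in> lpc p \<and> lpn p x \<le> C"
    using x assms powr_le_powr_cancel by blast
qed

lemma norm_component_le_lpn:
  assumes "0 < p" "x \<in> lpc p"
  shows "norm (x i) \<le> lpn p x"
proof -
  have "norm (x i) powr p \<le> (\<Sum>j<Suc i. norm (x j) powr p)"
    by (simp add: sum_nonneg)
  also have "\<dots> \<le> lpn p x powr p"
    using lpc_lpn_le_iff[THEN iffD1, rule_format, of p "lpn p x" x "Suc i"] assms by simp
  finally show ?thesis
    using assms powr_le_powr_cancel lpn_nonneg by blast
qed

lemma lpn_eq_0D: "0 < p \<Longrightarrow> x \<in> lpc p \<Longrightarrow> lpn p x = 0 \<Longrightarrow> x = 0"
  using norm_component_le_lpn[of p x] by (fastforce simp: zero_fun_def)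

lemma lpn_0 [simp]: "lpn p 0 = 0" "lpn p (\<lambda>n. 0) = 0"
  by (simp_all add: lpn_eq)

lemma lpc_0 [simp]: "0 \<in> lpc p" "(\<lambda>n. 0) \<in> lpc p"
  by (simp_all add: lpc_iff)

lemma lpc_scale [simp]: "x \<in> lpc p \<Longrightarrow> (\<lambda>n. c * x n) \<in> lpc p"
  by (simp add: lpc_iff norm_mult powr_mult summable_mult)

lemma lpn_scale:
  assumes "0 < p" "x \<in> lpc p"
  shows "lpn p (\<lambda>n. c * x n) = norm c * lpn p x"
  using assms
  by (simp add: lpn_eq lpc_iff norm_mult powr_mult suminf_mult summable_mult suminf_nonneg powr_powr)

lemma lpc_uminus [simp]: "x \<in> lpc p \<Longrightarrow> - x \<in> lpc p"
  by (simp add: lpc_iff)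

lemma lpn_uminus [simp]: "lpn p (- x) = lpn p x"
  by (simp add: lpn_eq)

lemma powr_convex_nonneg:
  fixes u v p t :: real
  assumes p: "1 \<le> p" and uv: "0 \<le> u" "0 \<le> v" and t: "0 < t" "t < 1"
  shows "((1 - t) * u + t * v) powr p \<le> (1 - t) * u powr p + t * v powr p"
proof -
  \<comment> \<open>When \<open>u\<close> or \<open>v\<close> vanishes, the claim reduces to
    this inequality for \<open>t\<close> or \<open>1 - t\<close>.\<close>
  have le: "c powr p \<le> c" if "0 < c" "c < 1" for c :: real
    using powr_mono'[of 1 p c] p that by simp
  consider "u = 0" | "v = 0" | "0 < u" "0 < v"
    using uv by linarith
  then show ?thesis
  proof cases
    case 1
    then show ?thesis
      using le[of t] t uv by (simp add: powr_mult mult_right_mono)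
  next
    case 2
    then show ?thesis
      using le[of "1 - t"] t uv by (simp add: powr_mult mult_right_mono)
  next
    case 3
    then show ?thesis
      using convex_onD[OF powr_convex[OF p], of t u v] t by simp
  qed
qed

text \<open>
  Minkowski's inequality. With \<open>a = \<parallel>x\<parallel>\<close> and \<open>b = \<parallel>y\<parallel>\<close>, the vector \<open>(x + y) / (a + b)\<close> is a
  convex combination of \<open>x / a\<close> and \<open>y / b\<close>, so the convexity of \<open>t \<mapsto> t\<^sup>p\<close> bounds each of its
  terms.
\<close>

lemma minkowski:
  fixes x y :: "nat \<Rightarrow> 'a::real_normed_field"
  assumes p: "1 \<le> p" and x: "x \<in> lpc p" and y: "y \<in> lpc p"
  shows "x + y \<in> lpc p \<and> lpn p (x + y) \<le> lpn p x + lpn p y"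
proof (cases "lpn p x = 0 \<or> lpn p y = 0")
  case True
  then show ?thesis
    using assms lpn_eq_0D[of p x] lpn_eq_0D[of p y] by fastforce
next
  case False
  define a b where "a = lpn p x" and "b = lpn p y"
  have ab: "0 < a" "0 < b"
    using False lpn_nonneg[of p x] lpn_nonneg[of p y] unfolding a_def b_def by linarith+
  have conv: "norm (x i + y i) powr p
      \<le> (a + b) powr p * (a / (a + b) * (norm (x i) powr p / a powr p) + b / (a + b) * (norm (y i) powr p / b powr p))"
    for i
  proof -
    define u v where "u = norm (x i) / a" and "v = norm (y i) / b"
    have uv: "0 \<le> u" "0 \<le> v"
      using ab by (auto simp: u_def v_def)
    have "norm (x i + y i) powr p \<le> (norm (x i) + norm (y i)) powr p"
      using p by (intro powr_mono2) (auto intro: norm_triangle_ineq)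
    also have "norm (x i) + norm (y i) = (a + b) * (a / (a + b) * u + b / (a + b) * v)"
      using ab by (simp add: u_def v_def distrib_left)
    also have "\<dots> powr p = (a + b) powr p * (a / (a + b) * u + b / (a + b) * v) powr p"
      by (rule powr_mult)
    also have "(a / (a + b) * u + b / (a + b) * v) powr p \<le> a / (a + b) * u powr p + b / (a + b) * v powr p"
    proof -
      have "a / (a + b) = 1 - b / (a + b)"
        using ab by (simp add: field_simps)
      then show ?thesis
        using powr_convex_nonneg[OF p uv, of "b / (a + b)"] ab by simp
    qed
    finally show ?thesis
      using ab by (simp add: u_def v_def powr_divide mult_left_mono)
  qed
  have le: "(\<Sum>i<n. norm ((x + y) i) powr p) \<le> (a + b) powr p" for n
  proof -
    have sx: "(\<Sum>i<n. norm (x i) powr p) / a powr p \<le> 1"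
      using lpc_lpn_le_iff[of p a x] p x ab by (auto simp: a_def divide_le_eq_1)
    have sy: "(\<Sum>i<n. norm (y i) powr p) / b powr p \<le> 1"
      using lpc_lpn_le_iff[of p b y] p y ab by (auto simp: b_def divide_le_eq_1)
    have "(\<Sum>i<n. norm ((x + y) i) powr p)
      \<le> (\<Sum>i<n. (a + b) powr p * (a / (a + b) * (norm (x i) powr p / a powr p)
            + b / (a + b) * (norm (y i) powr p / b powr p)))"
      using conv by (intro sum_mono) simp
    also have "\<dots> = (a + b) powr p * (a / (a + b) * ((\<Sum>i<n. norm (x i) powr p) / a powr p)
            + b / (a + b) * ((\<Sum>i<n. norm (y i) powr p) / b powr p))"
      by (simp only: sum_distrib_left[symmetric] sum.distrib sum_divide_distrib)
    also have "\<dots> \<le> (a + b) powr p * (a / (a + b) * 1 + b / (a + b) * 1)"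
      using ab sx sy by (intro mult_left_mono add_mono) auto
    also have "\<dots> = (a + b) powr p"
      using ab by (simp add: add_divide_distrib[symmetric])
    finally show ?thesis .
  qed
  then show ?thesis
    using lpc_lpn_le_iff[of p "a + b" "x + y"] p ab by (simp add: a_def b_def)
qed

lemma lpc_add [simp]: "1 \<le> p \<Longrightarrow> x \<in> lpc p \<Longrightarrow> y \<in> lpc p \<Longrightarrow> x + y \<in> lpc p"
  using minkowski by blast

lemma lpn_triangle: "1 \<le> p \<Longrightarrow> x \<in> lpc p \<Longrightarrow> y \<in> lpc p \<Longrightarrow> lpn p (x + y) \<le> lpn p x + lpn p y"
  using minkowski by blast

lemma lpc_diff [simp]: "1 \<le> p \<Longrightarrow> x \<in> lpc p \<Longrightarrow> y \<in> lpc p \<Longrightarrow> x - y \<in> lpc p"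
  using lpc_add[of p x "- y"] by simp

lemma lpn_triangle_diff: "1 \<le> p \<Longrightarrow> x \<in> lpc p \<Longrightarrow> y \<in> lpc p \<Longrightarrow> lpn p (x - y) \<le> lpn p x + lpn p y"
  using lpn_triangle[of p x "- y"] by simp

lemma lpn_minus_commute: "lpn p (x - y) = lpn p (y - x)"
  using lpn_uminus[of p "x - y"] by (simp del: lpn_uminus)

lemma lpn_diff_le: "1 \<le> p \<Longrightarrow> x \<in> lpc p \<Longrightarrow> y \<in> lpc p \<Longrightarrow> \<bar>lpn p x - lpn p y\<bar> \<le> lpn p (x - y)"
  using lpn_triangle[of p y "x - y"] lpn_triangle[of p x "y - x"] lpn_minus_commute[of p x y]
  by simp

text \<open>
  The discarded coordinates are replaced by \<open>0\<close> and the remaining ones keep their index, so that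
  \<open>restr E\<close> is a projection of norm at most \<open>1\<close> on every \<open>\<ell>\<^sub>p\<close>.
\<close>

definition restr :: "nat set \<Rightarrow> (nat \<Rightarrow> 'a::zero) \<Rightarrow> nat \<Rightarrow> 'a" where
  "restr E x = (\<lambda>i. if i \<in> E then x i else 0)"

lemma restr_apply: "restr E x i = (if i \<in> E then x i else 0)"
  by (simp add: restr_def)

lemma restr_add: "restr E (x + y) = restr E x + restr E (y :: nat \<Rightarrow> 'a::monoid_add)"
  by (auto simp: restr_def fun_eq_iff)

lemma restr_diff: "restr E (x - y) = restr E x - restr E (y :: nat \<Rightarrow> 'a::group_add)"
  by (auto simp: restr_def fun_eq_iff)

lemma restr_scale: "restr E (\<lambda>n. c * x n) = (\<lambda>n. c * restr E x n)" for c :: "'a::mult_zero"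
  by (auto simp: restr_def fun_eq_iff)

lemma restr_compl: "restr E x + restr (- E) x = (x :: nat \<Rightarrow> 'a::monoid_add)"
  by (auto simp: restr_def fun_eq_iff)

lemma restr_0 [simp]: "restr E 0 = 0"
  by (auto simp: restr_def fun_eq_iff)

lemma restr_restr: "restr E (restr F x) = restr (E \<inter> F) x"
  by (auto simp: restr_def fun_eq_iff)

lemma restr_lpc_le:
  assumes "0 < p" "x \<in> lpc p"
  shows "restr E x \<in> lpc p \<and> lpn p (restr E x) \<le> lpn p x"
proof (subst lpc_lpn_le_iff)
  show "\<forall>n. (\<Sum>i<n. norm (restr E x i) powr p) \<le> lpn p x powr p"
  proof
    fix n
    have "(\<Sum>i<n. norm (restr E x i) powr p) \<le> (\<Sum>i<n. norm (x i) powr p)"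
      by (intro sum_mono) (simp add: restr_apply)
    also have "\<dots> \<le> lpn p x powr p"
      using lpc_lpn_le_iff[of p "lpn p x" x] assms by auto
    finally show "(\<Sum>i<n. norm (restr E x i) powr p) \<le> lpn p x powr p" .
  qed
qed (use assms in auto)

lemma restr_lpc [simp]: "0 < p \<Longrightarrow> x \<in> lpc p \<Longrightarrow> restr E x \<in> lpc p"
  using restr_lpc_le by blast

lemma lpn_restr_le: "0 < p \<Longrightarrow> x \<in> lpc p \<Longrightarrow> lpn p (restr E x) \<le> lpn p x"
  using restr_lpc_le by blast

lemma lpn_disjoint_add:
  assumes "0 < p" "x \<in> lpc p" "y \<in> lpc p"
  shows "lpn p (restr E x + restr (- E) y) powr p = lpn p (restr E x) powr p + lpn p (restr (- E) y) powr p"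
    and "restr E x + restr (- E) y \<in> lpc p"
proof -
  have eq: "norm ((restr E x + restr (- E) y) i) powr p
      = norm (restr E x i) powr p + norm (restr (- E) y i) powr p" for i
    by (simp add: restr_apply)
  have s: "summable (\<lambda>i. norm (restr E x i) powr p)" "summable (\<lambda>i. norm (restr (- E) y i) powr p)"
    using assms by (simp_all flip: lpc_iff)
  then show in': "restr E x + restr (- E) y \<in> lpc p"
    unfolding lpc_iff eq by (rule summable_add)
  show "lpn p (restr E x + restr (- E) y) powr p = lpn p (restr E x) powr p + lpn p (restr (- E) y) powr p"
    using assms in' s by (simp only: lpn_powr restr_lpc eq suminf_add)
qed

lemma lpn_restr_tail_tendsto_0:
  assumes "0 < p" "x \<in> lpc p"
  shows "(\<lambda>n. lpn p (restr {n..} x)) \<longlonglongrightarrow> 0"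
proof -
  have s: "summable (\<lambda>i. norm (x i) powr p)"
    using assms by (simp add: lpc_iff)
  have "lpn p (restr {n..} x) powr p = (\<Sum>i. norm (x i) powr p) - (\<Sum>i<n. norm (x i) powr p)" for n
  proof -
    have "(\<lambda>i. norm (restr {..<n} x i) powr p) = (\<lambda>i. if i \<in> {..<n} then norm (x i) powr p else 0)"
      by (auto simp: restr_apply)
    then have "lpn p (restr {..<n} x) powr p = (\<Sum>i<n. norm (x i) powr p)"
      using assms sums_If_finite_set[of "{..<n}" "\<lambda>i. norm (x i) powr p"]
      by (simp add: lpn_powr sums_unique[symmetric])
    moreover have "- {..<n} = {n..}"
      by auto
    ultimately show ?thesis
      using lpn_disjoint_add(1)[of p x x "{..<n}"] assms restr_compl[of "{..<n}" x]
      by (simp add: lpn_powr)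
  qed
  moreover have "(\<lambda>n. (\<Sum>i. norm (x i) powr p) - (\<Sum>i<n. norm (x i) powr p)) \<longlonglongrightarrow> 0"
    using tendsto_diff[OF tendsto_const summable_LIMSEQ[OF s], of "\<Sum>i. norm (x i) powr p"] by simp
  ultimately have "(\<lambda>n. lpn p (restr {n..} x) powr p) \<longlonglongrightarrow> 0"
    by simp
  then have "(\<lambda>n. (lpn p (restr {n..} x) powr p) powr (1 / p)) \<longlonglongrightarrow> 0 powr (1 / p)"
    using assms by (intro tendsto_powr') auto
  then show ?thesis
    using assms by (simp add: powr_powr)
qed

lemma lpn_restr_finite_le:
  assumes p: "1 \<le> p" and fin: "finite E"
  shows "restr E x \<in> lpc p \<and> lpn p (restr E x) \<le> (\<Sum>i\<in>E. norm (x i))"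
  using fin
proof induction
  case empty
  have "restr {} x = 0"
    by (auto simp: restr_def)
  then show ?case
    by simp
next
  case (insert k E)
  have split: "restr (insert k E) x = restr {k} x + restr E x"
    using insert by (auto simp: restr_def fun_eq_iff)
  have single: "(\<lambda>i. norm (restr {k} x i) powr p) = (\<lambda>i. if i = k then norm (x i) powr p else 0)"
    by (auto simp: restr_apply)
  have k: "restr {k} x \<in> lpc p"
    unfolding lpc_iff single by simp
  have "lpn p (restr {k} x) = norm (x k)"
    unfolding lpn_eq single using p sums_single[of k "\<lambda>i. norm (x i) powr p"]
    by (simp add: sums_unique[symmetric] powr_powr)
  moreover have E: "restr E x \<in> lpc p"
    using insert.IH by blast
  ultimately have "lpn p (restr {k} x + restr E x) \<le> (\<Sum>i\<in>insert k E. norm (x i))"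
    using insert lpn_triangle[OF p k E] by simp
  then show ?case
    using lpc_add[OF p k E] unfolding split by blast
qed

lemma lpn_restr_finite_tendsto_0:
  assumes "1 \<le> p" "finite E" "\<And>i. (\<lambda>n. w n i) \<longlonglongrightarrow> 0"
  shows "(\<lambda>n. lpn p (restr E (w n))) \<longlonglongrightarrow> 0"
proof (rule Lim_null_comparison)
  show "\<forall>\<^sub>F n in sequentially. norm (lpn p (restr E (w n))) \<le> (\<Sum>i\<in>E. norm (w n i))"
    by (intro always_eventually allI) (simp add: lpn_restr_finite_le[OF assms(1,2)])
  show "(\<lambda>n. \<Sum>i\<in>E. norm (w n i)) \<longlonglongrightarrow> 0"
    by (intro tendsto_null_sum tendsto_norm_zero assms(3))
qed

section \<open>Bounded operators between sequence spaces\<close>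

abbreviation opc :: "real \<Rightarrow> real \<Rightarrow> ((nat \<Rightarrow> 'a::real_normed_field) \<Rightarrow> nat \<Rightarrow> 'a) set" where
  "opc p q \<equiv> vecs (bops (lp p) (lp q))"

abbreviation opn :: "real \<Rightarrow> real \<Rightarrow> ((nat \<Rightarrow> 'a::real_normed_field) \<Rightarrow> nat \<Rightarrow> 'a) \<Rightarrow> real" where
  "opn p q \<equiv> nrm (bops (lp p) (lp q))"

lemma unit_ball_lp_iff: "x \<in> unit_ball (lp p) \<longleftrightarrow> x \<in> lpc p \<and> lpn p x \<le> 1"
  by (simp add: unit_ball_def)

lemma zero_in_unit_ball [simp]: "0 \<in> unit_ball (lp p)"
  by (simp add: unit_ball_lp_iff)

lemma opcI:
  assumes "\<And>x. x \<in> lpc p \<Longrightarrow> T x \<in> lpc q"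
    and "\<And>x y. x \<in> lpc p \<Longrightarrow> y \<in> lpc p \<Longrightarrow> T (x + y) = T x + T y"
    and "\<And>c x. x \<in> lpc p \<Longrightarrow> T (\<lambda>n. c * x n) = (\<lambda>n. c * T x n)"
    and "\<And>x. x \<in> lpc p \<Longrightarrow> lpn q (T x) \<le> C * lpn p x"
    and "\<And>x. x \<notin> lpc p \<Longrightarrow> T x = 0"
  shows "T \<in> opc p q"
  using assms by (auto simp: bops_def intro!: exI[of _ C])

lemma
  assumes "T \<in> opc p q"
  shows op_lpc: "x \<in> lpc p \<Longrightarrow> T x \<in> lpc q"
    and op_add: "x \<in> lpc p \<Longrightarrow> y \<in> lpc p \<Longrightarrow> T (x + y) = T x + T y"
    and op_scale: "x \<in> lpc p \<Longrightarrow> T (\<lambda>n. c * x n) = (\<lambda>n. c * T x n)"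
    and op_outside: "x \<notin> lpc p \<Longrightarrow> T x = 0"
    and op_bounded: "\<exists>C. \<forall>x\<in>lpc p. lpn q (T x) \<le> C * lpn p x"
  using assms unfolding bops_def nspace.simps mem_Collect_eq smul_lp by blast+

lemma op_uminus: "T \<in> opc p q \<Longrightarrow> x \<in> lpc p \<Longrightarrow> T (- x) = - T x"
proof -
  assume T: "T \<in> opc p q" and x: "x \<in> lpc p"
  have "(\<lambda>n. - 1 * z n) = - z" for z :: "nat \<Rightarrow> 'a"
    by (simp add: fun_eq_iff)
  then show ?thesis
    using op_scale[OF T x, of "-1"] by metis
qed

lemma op_diff: "T \<in> opc p q \<Longrightarrow> x \<in> lpc p \<Longrightarrow> y \<in> lpc p \<Longrightarrow> T (x - y) = T x - T y"
  using op_add[of T p q x "- y"] by (simp add: op_uminus[of T p q y])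

lemma op_0: "T \<in> opc p q \<Longrightarrow> T 0 = 0"
  using op_add[of T p q 0 0] by simp

lemma opn_eq: "opn p q T = (SUP x\<in>unit_ball (lp p). lpn q (T x))"
  by (simp add: bops_def)

lemma bdd_above_op:
  assumes "T \<in> opc p q"
  shows "bdd_above ((\<lambda>x. lpn q (T x)) ` unit_ball (lp p))"
proof -
  have "\<exists>C. \<forall>x\<in>lpc p. lpn q (T x) \<le> C * lpn p x"
    using assms by (rule op_bounded)
  then obtain C where C: "\<And>x. x \<in> lpc p \<Longrightarrow> lpn q (T x) \<le> C * lpn p x"
    by blast
  have "lpn q (T x) \<le> \<bar>C\<bar>" if "x \<in> unit_ball (lp p)" for x
  proof -
    have "lpn q (T x) \<le> C * lpn p x"
      using that C by (simp add: unit_ball_lp_iff)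
    also have "\<dots> \<le> \<bar>C\<bar> * 1"
      using that by (intro mult_mono) (auto simp: unit_ball_lp_iff)
    finally show ?thesis
      by simp
  qed
  then show ?thesis
    by (meson bdd_aboveI2)
qed

lemma opn_ball: "T \<in> opc p q \<Longrightarrow> x \<in> unit_ball (lp p) \<Longrightarrow> lpn q (T x) \<le> opn p q T"
  unfolding opn_eq by (intro cSUP_upper bdd_above_op)

lemma opn_le: "(\<And>x. x \<in> unit_ball (lp p) \<Longrightarrow> lpn q (T x) \<le> C) \<Longrightarrow> opn p q T \<le> C"
  unfolding opn_eq using zero_in_unit_ball by (intro cSUP_least) blast+

lemma opn_nonneg: "T \<in> opc p q \<Longrightarrow> 0 \<le> opn p q T"
  using opn_ball[OF _ zero_in_unit_ball] lpn_nonneg order_trans by blast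

lemma opn_less_witness: "T \<in> opc p q \<Longrightarrow> C < opn p q T \<Longrightarrow> \<exists>x\<in>unit_ball (lp p). C < lpn q (T x)"
  using opn_le[of p q T C] by force

lemma opn_bound:
  assumes "0 < p" "0 < q" and T: "T \<in> opc p q" and x: "x \<in> lpc p"
  shows "lpn q (T x) \<le> opn p q T * lpn p x"
proof (cases "lpn p x = 0")
  case True
  then show ?thesis
    using lpn_eq_0D[OF \<open>0 < p\<close> x] op_0[OF T] by simp
next
  case False
  define c where "c = (of_real (1 / lpn p x) :: 'a)"
  have pos: "0 < lpn p x"
    using False lpn_nonneg[of p x] by linarith
  have nc: "norm c = 1 / lpn p x"
    using pos unfolding c_def norm_of_real by simp
  have "(\<lambda>n. c * x n) \<in> unit_ball (lp p)"
    using assms pos nc by (simp add: unit_ball_lp_iff lpn_scale)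
  from opn_ball[OF T this] have "norm c * lpn q (T x) \<le> opn p q T"
    using assms by (simp add: op_scale[OF T x] lpn_scale op_lpc[OF T])
  then show ?thesis
    using nc pos by (simp add: field_simps)
qed

lemma op_plus [simp]:
  assumes "0 < p" "1 \<le> q" "S \<in> opc p q" "T \<in> opc p q"
  shows "S + T \<in> opc p q"
proof (rule opcI[where C = "opn p q S + opn p q T"])
  show "lpn q ((S + T) x) \<le> (opn p q S + opn p q T) * lpn p x" if "x \<in> lpc p" for x
    using lpn_triangle[of q "S x" "T x"] opn_bound[of p q S x] opn_bound[of p q T x] that assms
    by (simp add: op_lpc[OF assms(3)] op_lpc[OF assms(4)] distrib_right)
qed (use assms in \<open>auto simp: op_lpc[OF assms(3)] op_lpc[OF assms(4)] op_add[OF assms(3)] op_add[OF assms(4)]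
    op_scale[OF assms(3)] op_scale[OF assms(4)] op_outside[OF assms(3)] op_outside[OF assms(4)] distrib_left\<close>)

lemma op_scale_in [simp]:
  assumes "0 < p" "0 < q" "T \<in> opc p q"
  shows "(\<lambda>x n. c * T x n) \<in> opc p q"
proof (rule opcI[where C = "norm c * opn p q T"])
  show "lpn q (\<lambda>n. c * T x n) \<le> norm c * opn p q T * lpn p x" if "x \<in> lpc p" for x
    using opn_bound[of p q T x] that assms by (simp add: op_lpc[OF assms(3)] lpn_scale mult_left_mono mult.assoc)
qed (use assms in \<open>auto simp: op_lpc[OF assms(3)] op_add[OF assms(3)] op_scale[OF assms(3)]
    op_outside[OF assms(3)] fun_eq_iff distrib_left mult_ac\<close>)

lemma opn_scale:
  assumes "0 < p" "0 < q" "T \<in> opc p q"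
  shows "opn p q (\<lambda>x n. c * T x n) \<le> norm c * opn p q T"
proof (rule opn_le)
  show "lpn q (\<lambda>n. c * T x n) \<le> norm c * opn p q T" if "x \<in> unit_ball (lp p)" for x
    using that opn_ball[of T p q x] assms
    by (simp add: lpn_scale mult_left_mono unit_ball_lp_iff op_lpc[OF assms(3)])
qed

lemma op_neg:
  assumes "0 < p" "0 < q" "T \<in> opc p q"
  shows "- T \<in> opc p q" "opn p q (- T) = opn p q T"
proof -
  have "- T = (\<lambda>x n. - 1 * T x n)"
    by (auto simp: fun_eq_iff)
  then show "- T \<in> opc p q"
    using op_scale_in[OF assms, of "-1"] by simp
  show "opn p q (- T) = opn p q T"
    by (simp add: opn_eq)
qed

lemma op_minus [simp]:
  assumes "0 < p" "1 \<le> q" "S \<in> opc p q" "T \<in> opc p q"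
  shows "S - T \<in> opc p q"
  using op_plus[of p q S "- T"] op_neg[of p q T] assms by simp

lemma op_restr [simp]:
  assumes "0 < p" "0 < q" "T \<in> opc p q"
  shows "(\<lambda>x. restr E (T x)) \<in> opc p q"
proof (rule opcI[where C = "opn p q T"])
  show "lpn q (restr E (T x)) \<le> opn p q T * lpn p x" if "x \<in> lpc p" for x
    using lpn_restr_le[of q "T x" E] opn_bound[of p q T x] op_lpc[of T p q x] that assms by simp
qed (use assms in \<open>auto simp: op_lpc[OF assms(3)] op_add[OF assms(3)] op_scale[OF assms(3)]
    op_outside[OF assms(3)] restr_add restr_scale\<close>)

lemma phase_ball:
  assumes "0 < p" "norm c = 1" "x \<in> unit_ball (lp p)"
  shows "(\<lambda>n. c * x n) \<in> unit_ball (lp p)"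
  using assms by (simp add: unit_ball_lp_iff lpn_scale)

section \<open>Coordinatewise convergence\<close>

text \<open>A product of closed balls is compact by Tychonoff's theorem, and a countable product is metrizable.\<close>

lemma coordinatewise_convergent_subsequence:
  fixes x :: "nat \<Rightarrow> nat \<Rightarrow> 'a::{real_normed_vector, heine_borel}"
  assumes "\<And>n i. norm (x n i) \<le> C"
  shows "\<exists>l r. strict_mono r \<and> (\<forall>i. (\<lambda>n. x (r n) i) \<longlonglongrightarrow> l i)"
proof -
  have "compactin (product_topology (\<lambda>_. euclidean) UNIV) (PiE UNIV (\<lambda>_::nat. cball (0::'a) C))"
    by (simp add: compactin_PiE)
  then have "compact (PiE UNIV (\<lambda>_::nat. cball (0::'a) C))"
    by (simp add: euclidean_product_topology)
  then have "seq_compact (PiE UNIV (\<lambda>_::nat. cball (0::'a) C))"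
    by (rule compact_imp_seq_compact)
  moreover have "\<forall>n. x n \<in> PiE UNIV (\<lambda>_. cball 0 C)"
    using assms by (simp add: PiE_UNIV_domain)
  ultimately obtain l r where r: "strict_mono r" "(x \<circ> r) \<longlonglongrightarrow> l"
    unfolding seq_compact_def by blast
  have "(\<lambda>n. x (r n) i) \<longlonglongrightarrow> l i" for i
    using continuous_on_tendsto_compose[OF continuous_on_product_coordinates r(2), of i]
    by (simp add: comp_def)
  then show ?thesis
    using r(1) by blast
qed

text \<open>
  The locale collects what is needed of a bounded functional; the instances of interest are the
  coordinates of an operator, \<open>x \<mapsto> T x j\<close>.
\<close>

locale lp_functional =
  fixes p :: real and h :: "(nat \<Rightarrow> 'a::real_normed_field) \<Rightarrow> 'a" and C :: real
  assumes p: "1 < p"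
    and add: "\<And>x y. x \<in> lpc p \<Longrightarrow> y \<in> lpc p \<Longrightarrow> h (x + y) = h x + h y"
    and scale: "\<And>c x. x \<in> lpc p \<Longrightarrow> h (\<lambda>n. c * x n) = c * h x"
    and bound: "\<And>x. x \<in> lpc p \<Longrightarrow> norm (h x) \<le> C * lpn p x"
begin

lemma norm_le_abs_bound:
  assumes "x \<in> lpc p"
  shows "norm (h x) \<le> \<bar>C\<bar> * lpn p x"
proof -
  have "C * lpn p x \<le> \<bar>C\<bar> * lpn p x"
    by (intro mult_right_mono) auto
  then show ?thesis
    using bound[OF assms] by linarith
qed

lemma exponent_pos: "0 < p" "1 \<le> p"
  using p by auto

text \<open>
  If \<open>h\<close> exceeds \<open>e\<close> in absolute value on vectors of the unit ball arbitrarily far out, choose two of them with disjoint supports,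
  rotate them so that both values are positive, and add: the value exceeds \<open>2 e\<close>, while the norm of the
  sum is at most \<open>2\<^bsup>1/p\<^esup>\<close>. After normalization \<open>h\<close> exceeds \<open>2\<^bsup>1 - 1/p\<^esup> e\<close>, again arbitrarily far out.
\<close>

lemma tail_values_amplify:
  assumes "\<And>N. \<exists>x\<in>unit_ball (lp p). (\<forall>i<N. x i = 0) \<and> e < norm (h x)" and "0 \<le> e"
  shows "\<exists>x\<in>unit_ball (lp p). (\<forall>i<N. x i = 0) \<and> 2 powr (1 - 1 / p) * e < norm (h x)"
proof -
  obtain x where x: "x \<in> lpc p" "lpn p x \<le> 1" "\<forall>i<N. x i = 0" "e < norm (h x)"
    using assms(1)[of N] by (auto simp: unit_ball_lp_iff)
  have "(\<lambda>M. \<bar>C\<bar> * lpn p (restr {M..} x)) \<longlonglongrightarrow> \<bar>C\<bar> * 0"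
    using lpn_restr_tail_tendsto_0[OF exponent_pos(1) x(1)] by (intro tendsto_mult tendsto_const)
  then have "\<forall>\<^sub>F M in sequentially. \<bar>C\<bar> * lpn p (restr {M..} x) < norm (h x) - e"
    using x by (intro order_tendstoD(2)) auto
  then obtain M where M: "\<bar>C\<bar> * lpn p (restr {M..} x) < norm (h x) - e"
    by (auto simp: eventually_sequentially)
  define E where "E = {M..}"
  define u where "u = restr (- E) x"
  have xin: "restr E x \<in> lpc p" and u: "u \<in> lpc p"
    using x exponent_pos by (auto simp: u_def)
  have "h x = h (restr E x) + h u"
    using add[OF xin u] by (simp add: u_def restr_compl)
  then have "norm (h x) \<le> norm (h (restr E x)) + norm (h u)"
    by (simp add: norm_triangle_ineq)
  then have hu: "e < norm (h u)"
    using M norm_le_abs_bound[OF xin] by (simp add: E_def)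
  have nu: "lpn p u \<le> 1"
    using lpn_restr_le[OF exponent_pos(1) x(1), of "- E"] x by (simp add: u_def)
  \<comment> \<open>\<open>u\<close> lives below \<open>M\<close> and \<open>y\<close> from
    \<open>M\<close> on; the maximum makes the sum vanish below \<open>N\<close>.\<close>
  obtain y where y: "y \<in> lpc p" "lpn p y \<le> 1" "\<forall>i<max M N. y i = 0" "e < norm (h y)"
    using assms(1)[of "max M N"] by (auto simp: unit_ball_lp_iff)
  define a b where "a = of_real (norm (h u)) / h u" and "b = of_real (norm (h y)) / h y"
  have ab: "norm a = 1" "norm b = 1" "a * h u = of_real (norm (h u))" "b * h y = of_real (norm (h y))"
    using hu y(4) \<open>0 \<le> e\<close> by (auto simp: a_def b_def norm_divide)
  define c where "c = (of_real (2 powr (- 1 / p)) :: 'a)"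
  define v w where "v = (\<lambda>n. a * u n)" and "w = (\<lambda>n. b * y n)"
  have vw: "v \<in> lpc p" "w \<in> lpc p" "lpn p v \<le> 1" "lpn p w \<le> 1"
    using u y nu ab exponent_pos by (auto simp: v_def w_def lpn_scale)
  have eqs: "restr E w = w" "restr (- E) v = v"
    using y(3) by (auto simp: E_def v_def w_def u_def restr_def fun_eq_iff)
  have wv: "w + v \<in> lpc p"
    using vw exponent_pos by simp
  have "lpn p (w + v) powr p = lpn p w powr p + lpn p v powr p"
    using lpn_disjoint_add(1)[OF exponent_pos(1) vw(2,1), of E] by (simp add: eqs)
  also have "\<dots> \<le> 1 + 1"
    using vw p by (intro add_mono powr_le1) auto
  finally have "(lpn p (w + v) powr p) powr (1 / p) \<le> 2 powr (1 / p)"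
    using p by (intro powr_mono2) auto
  then have le: "lpn p (w + v) \<le> 2 powr (1 / p)"
    using p by (simp add: powr_powr)
  define z where "z = (\<lambda>n. c * (w + v) n)"
  have nc: "norm c = 2 powr (- 1 / p)"
    by (simp add: c_def)
  have "lpn p z \<le> 2 powr (- 1 / p) * 2 powr (1 / p)"
    unfolding z_def lpn_scale[OF exponent_pos(1) wv] nc using le by (intro mult_left_mono) auto
  also have "\<dots> = 1"
    by (simp flip: powr_add)
  finally have "z \<in> unit_ball (lp p)"
    using lpc_scale[OF wv] by (simp add: unit_ball_lp_iff z_def)
  moreover have "\<forall>i<N. z i = 0"
    using x(3) y(3) by (auto simp: z_def v_def w_def u_def restr_def)
  moreover have "2 powr (1 - 1 / p) * e < norm (h z)"
  proof -
    have "h z = c * (of_real (norm (h y)) + of_real (norm (h u)))"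
      unfolding z_def scale[OF wv] add[OF vw(2,1)]
      using scale[OF y(1), of b] scale[OF u, of a] ab by (simp add: v_def w_def)
    then have "norm (h z) = 2 powr (- 1 / p) * (norm (h y) + norm (h u))"
      unfolding of_real_add[symmetric] by (simp only: norm_mult norm_of_real nc) simp
    moreover have "2 powr (- 1 / p) * (e + e) < 2 powr (- 1 / p) * (norm (h y) + norm (h u))"
      using hu y(4) by (intro mult_strict_left_mono) auto
    moreover have "2 powr (1 - 1 / p) = 2 powr (- 1 / p) * 2"
      using powr_add[of 2 1 "- 1 / p"] by simp
    ultimately show ?thesis
      by simp
  qed
  ultimately show ?thesis
    by blast
qed

text \<open>
  As \<open>1 < p\<close>, the factor in \<open>tail_values_amplify\<close> is greater than \<open>1\<close>. Iterating it would push \<open>h\<close>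
  above its bound on the unit ball.
\<close>

lemma small_on_tails:
  assumes "0 < e"
  shows "\<exists>N. \<forall>x\<in>unit_ball (lp p). (\<forall>i<N. x i = 0) \<longrightarrow> norm (h x) \<le> e"
proof (rule ccontr)
  assume neg: "\<not> ?thesis"
  define \<rho> :: real where "\<rho> = 2 powr (1 - 1 / p)"
  have rho: "1 < \<rho>"
    using p by (simp add: \<rho>_def)
  have grow: "\<exists>x\<in>unit_ball (lp p). (\<forall>i<N. x i = 0) \<and> \<rho> ^ k * e < norm (h x)" for k N
  proof (induction k arbitrary: N)
    case 0
    then show ?case
      using neg by (auto simp: not_le)
  next
    case (Suc k)
    then show ?case
      using tail_values_amplify[of "\<rho> ^ k * e" N] rho assms by (simp add: \<rho>_def mult.assoc)
  qed
  obtain k where "\<bar>C\<bar> / e < \<rho> ^ k"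
    using real_arch_pow[OF rho] by blast
  then have k: "\<bar>C\<bar> < \<rho> ^ k * e"
    using assms by (simp add: field_simps)
  obtain x where "x \<in> unit_ball (lp p)" "\<rho> ^ k * e < norm (h x)"
    using grow by blast
  moreover from this have "norm (h x) \<le> \<bar>C\<bar> * 1"
    using norm_le_abs_bound[of x] mult_left_mono[of "lpn p x" 1 "\<bar>C\<bar>"] by (auto simp: unit_ball_lp_iff)
  ultimately show False
    using k by linarith
qed

text \<open>
  A bounded sequence that tends to \<open>0\<close> in each coordinate is weakly null: its initial segments tend
  to \<open>0\<close> in norm, and on its tails \<open>h\<close> is uniformly small.
\<close>

lemma tendsto_0_coordinatewise:
  assumes w: "\<And>n. w n \<in> lpc p" "\<And>n. lpn p (w n) \<le> B" and 0: "\<And>i. (\<lambda>n. w n i) \<longlonglongrightarrow> 0"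
  shows "(\<lambda>n. h (w n)) \<longlonglongrightarrow> 0"
proof (rule LIMSEQ_I)
  fix e :: real
  assume e: "0 < e"
  have B: "0 \<le> B"
    using w(2)[of 0] lpn_nonneg order_trans by blast
  \<comment> \<open>Dividing by \<open>B + 1\<close> rather than \<open>B\<close> brings the
    sequence into the unit ball also when \<open>B = 0\<close>.\<close>
  obtain N where N: "\<And>x. x \<in> unit_ball (lp p) \<Longrightarrow> (\<forall>i<N. x i = 0) \<Longrightarrow> norm (h x) \<le> e / (2 * (B + 1))"
    using small_on_tails[of "e / (2 * (B + 1))"] e B by auto
  have tail: "norm (h (restr {N..} (w n))) \<le> e / 2" for n
  proof -
    define c where "c = (of_real (1 / (B + 1)) :: 'a)"
    have nc: "norm c = 1 / (B + 1)"
      unfolding c_def norm_of_real using B by simp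
    have wN: "restr {N..} (w n) \<in> lpc p"
      using w exponent_pos by simp
    have "lpn p (restr {N..} (w n)) \<le> B + 1"
      using lpn_restr_le[OF exponent_pos(1) w(1), of "{N..}" n] w(2)[of n] by linarith
    then have "(\<lambda>i. c * restr {N..} (w n) i) \<in> unit_ball (lp p)"
      using lpc_scale[OF wN, of c] lpn_scale[OF exponent_pos(1) wN, of c] B
      by (simp add: unit_ball_lp_iff nc)
    then have "norm (h (\<lambda>i. c * restr {N..} (w n) i)) \<le> e / (2 * (B + 1))"
      by (rule N) (simp add: restr_apply)
    then have "1 / (B + 1) * norm (h (restr {N..} (w n))) \<le> 1 / (B + 1) * (e / 2)"
      by (simp add: scale[OF wN] norm_mult nc mult.commute)
    then show ?thesis
      using B by (subst (asm) mult_le_cancel_left_pos) auto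
  qed
  have "(\<lambda>n. \<bar>C\<bar> * lpn p (restr {..<N} (w n))) \<longlonglongrightarrow> \<bar>C\<bar> * 0"
    using lpn_restr_finite_tendsto_0[OF exponent_pos(2), of "{..<N}" w] 0 by (intro tendsto_mult tendsto_const) auto
  then have "\<forall>\<^sub>F n in sequentially. \<bar>C\<bar> * lpn p (restr {..<N} (w n)) < e / 2"
    using e by (intro order_tendstoD(2)) auto
  then obtain n0 where n0: "\<And>n. n0 \<le> n \<Longrightarrow> \<bar>C\<bar> * lpn p (restr {..<N} (w n)) < e / 2"
    by (auto simp: eventually_sequentially)
  have "norm (h (w n)) < e" if "n0 \<le> n" for n
  proof -
    have in': "restr {..<N} (w n) \<in> lpc p" "restr {N..} (w n) \<in> lpc p"
      using w exponent_pos by auto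
    have "- {..<N} = {N..}"
      by auto
    then have "h (w n) = h (restr {..<N} (w n)) + h (restr {N..} (w n))"
      using add[OF in'] restr_compl[of "{..<N}" "w n"] by simp
    then have "norm (h (w n)) \<le> norm (h (restr {..<N} (w n))) + norm (h (restr {N..} (w n)))"
      by (simp add: norm_triangle_ineq)
    then show ?thesis
      using tail[of n] n0[OF that] norm_le_abs_bound[OF in'(1)] by linarith
  qed
  then show "\<exists>n0. \<forall>n\<ge>n0. norm (h (w n) - 0) < e"
    by auto
qed

end

text \<open>
  An \<open>\<ell>\<^sub>p\<close> analogue of the Brezis-Lieb lemma. Up to small errors \<open>x\<close> is supported below some \<open>M\<close> and,
  for large \<open>n\<close>, \<open>w n\<close> is supported from \<open>M\<close> on; for disjoint supports the \<open>p\<close>-th powers of the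
  norms add up exactly.
\<close>

lemma brezis_lieb:
  assumes p: "1 \<le> p" and x: "x \<in> lpc p" and w: "\<And>n. w n \<in> lpc p"
    and 0: "\<And>i. (\<lambda>n. w n i) \<longlonglongrightarrow> 0" and b: "(\<lambda>n. lpn p (w n)) \<longlonglongrightarrow> b"
  shows "(\<lambda>n. lpn p (x + w n)) \<longlonglongrightarrow> (lpn p x powr p + b powr p) powr (1 / p)"
proof (rule LIMSEQ_I)
  fix e :: real
  assume e: "0 < e"
  have p0: "0 < p"
    using p by simp
  have b0: "0 \<le> b"
    using b by (rule LIMSEQ_le_const) auto
  define F where "F s = (s powr p + b powr p) powr (1 / p)" for s
  have F: "(\<lambda>n. (s n powr p + s' n powr p) powr (1 / p)) \<longlonglongrightarrow> F l"
    if "s \<longlonglongrightarrow> l" "s' \<longlonglongrightarrow> b" "\<And>n. 0 \<le> s n" "\<And>n. 0 \<le> s' n" for s s' l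
    unfolding F_def using that p0 by (intro tendsto_powr' tendsto_add tendsto_const) auto
  have compl: "- {..<M} = {M..}" for M :: nat
    by auto
  have head: "\<bar>lpn p y - lpn p (restr {M..} y)\<bar> \<le> lpn p (restr {..<M} y)"
    "\<bar>lpn p y - lpn p (restr {..<M} y)\<bar> \<le> lpn p (restr {M..} y)" if "y \<in> lpc p" for y :: "nat \<Rightarrow> 'a" and M
  proof -
    have "y - restr {M..} y = restr {..<M} y" "y - restr {..<M} y = restr {M..} y"
      by (auto simp: restr_def fun_eq_iff)
    then show "\<bar>lpn p y - lpn p (restr {M..} y)\<bar> \<le> lpn p (restr {..<M} y)"
      "\<bar>lpn p y - lpn p (restr {..<M} y)\<bar> \<le> lpn p (restr {M..} y)"
      using lpn_diff_le[OF p that, of "restr {M..} y"] lpn_diff_le[OF p that, of "restr {..<M} y"] that p0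
      by auto
  qed
  have tail0: "(\<lambda>M. lpn p (restr {M..} x)) \<longlonglongrightarrow> 0"
    by (rule lpn_restr_tail_tendsto_0[OF p0 x])
  have "(\<lambda>M. lpn p x - lpn p (restr {..<M} x)) \<longlonglongrightarrow> 0"
    using head(2)[OF x] by (intro Lim_null_comparison[OF _ tail0]) auto
  then have "(\<lambda>M. lpn p (restr {..<M} x)) \<longlonglongrightarrow> lpn p x"
    using tendsto_diff[OF tendsto_const, of _ 0 sequentially "lpn p x"] by fastforce
  then have "(\<lambda>M. (lpn p (restr {..<M} x) powr p + b powr p) powr (1 / p)) \<longlonglongrightarrow> F (lpn p x)"
    using b0 by (intro F) auto
  then have "\<forall>\<^sub>F M in sequentially. dist (F (lpn p (restr {..<M} x))) (F (lpn p x)) < e / 4"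
    unfolding F_def using e by (intro tendstoD) auto
  moreover have "\<forall>\<^sub>F M in sequentially. lpn p (restr {M..} x) < e / 4"
    using tail0 e by (intro order_tendstoD(2)) auto
  ultimately have "\<forall>\<^sub>F M in sequentially. dist (F (lpn p (restr {..<M} x))) (F (lpn p x)) < e / 4 \<and>
      lpn p (restr {M..} x) < e / 4"
    by (rule eventually_conj)
  then obtain M where M: "dist (F (lpn p (restr {..<M} x))) (F (lpn p x)) < e / 4"
      "lpn p (restr {M..} x) < e / 4"
    by (auto simp: eventually_sequentially)
  have w0: "(\<lambda>n. lpn p (restr {..<M} (w n))) \<longlonglongrightarrow> 0"
    using 0 by (intro lpn_restr_finite_tendsto_0[OF p]) auto
  have "(\<lambda>n. lpn p (w n) - lpn p (restr {M..} (w n))) \<longlonglongrightarrow> 0"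
    using head(1)[OF w] by (intro Lim_null_comparison[OF _ w0]) auto
  then have "(\<lambda>n. lpn p (restr {M..} (w n))) \<longlonglongrightarrow> b"
    using tendsto_diff[OF b, of _ 0] by fastforce
  then have "(\<lambda>n. (lpn p (restr {..<M} x) powr p + lpn p (restr {M..} (w n)) powr p) powr (1 / p))
      \<longlonglongrightarrow> F (lpn p (restr {..<M} x))"
    by (intro F) auto
  moreover have B: "(lpn p (restr {..<M} x) powr p + lpn p (restr {M..} (w n)) powr p) powr (1 / p)
      = lpn p (restr {..<M} x + restr {M..} (w n))" for n
    using lpn_disjoint_add(1)[OF p0 x w, of "{..<M}" n, symmetric] p0 by (simp add: compl powr_powr)
  ultimately have "\<forall>\<^sub>F n in sequentially.
      dist (lpn p (restr {..<M} x + restr {M..} (w n))) (F (lpn p (restr {..<M} x))) < e / 4"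
    using e by (intro tendstoD) auto
  moreover have "\<forall>\<^sub>F n in sequentially. lpn p (restr {..<M} (w n)) < e / 4"
    using w0 e by (intro order_tendstoD(2)) auto
  ultimately have "\<forall>\<^sub>F n in sequentially. norm (lpn p (x + w n) - F (lpn p x)) < e"
  proof eventually_elim
    case (elim n)
    have in': "restr {M..} x \<in> lpc p" "restr {..<M} (w n) \<in> lpc p"
      "restr {..<M} x + restr {M..} (w n) \<in> lpc p" "x + w n \<in> lpc p"
      using x w p p0 by auto
    have eq: "x + w n - (restr {..<M} x + restr {M..} (w n)) = restr {M..} x + restr {..<M} (w n)"
      by (auto simp: restr_def fun_eq_iff)
    have "\<bar>lpn p (x + w n) - lpn p (restr {..<M} x + restr {M..} (w n))\<bar>
        \<le> lpn p (restr {M..} x) + lpn p (restr {..<M} (w n))"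
      using lpn_diff_le[OF p in'(4,3)] lpn_triangle[OF p in'(1,2)] unfolding eq by linarith
    then show ?case
      using elim M unfolding dist_real_def real_norm_def by argo
  qed
  then show "\<exists>n0. \<forall>n\<ge>n0. norm (lpn p (x + w n) - (lpn p x powr p + b powr p) powr (1 / p)) < e"
    by (auto simp: eventually_sequentially F_def)
qed

section \<open>Compact operators and the essential norm\<close>

lemma Metric_space_lp: "1 \<le> q \<Longrightarrow> Metric_space (lpc q) (\<lambda>x y. lpn q (x - y))"
proof
  fix x y z :: "nat \<Rightarrow> 'a"
  assume q: "1 \<le> q" and x: "x \<in> lpc q" and y: "y \<in> lpc q"
  show "lpn q (x - y) = 0 \<longleftrightarrow> x = y"
    using lpn_eq_0D[of q "x - y"] q x y by auto
  assume z: "z \<in> lpc q"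
  show "lpn q (x - z) \<le> lpn q (x - y) + lpn q (y - z)"
    using lpn_triangle[of q "x - y" "y - z"] q x y z by simp
qed (auto simp: lpn_minus_commute)

lemma limitin_lp_iff:
  assumes "1 \<le> q" "\<And>n. s n \<in> lpc q"
  shows "limitin (norm_topology (lp q)) s l sequentially
    \<longleftrightarrow> l \<in> lpc q \<and> (\<lambda>n. lpn q (s n - l)) \<longlonglongrightarrow> 0"
  using assms
  by (simp add: norm_topology_def Metric_space.limitin_metric_dist_null[OF Metric_space_lp])

lemma compactin_lp_iff:
  assumes "1 \<le> q"
  shows "compactin (norm_topology (lp q)) S \<longleftrightarrow> S \<subseteq> lpc q \<and>
    (\<forall>s. range s \<subseteq> S \<longrightarrow> (\<exists>l r. l \<in> S \<and> strict_mono (r::nat \<Rightarrow> nat) \<and> (\<lambda>n. lpn q (s (r n) - l)) \<longlonglongrightarrow> 0))"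
proof -
  have eq: "limitin (norm_topology (lp q)) (s \<circ> r) l sequentially \<longleftrightarrow> (\<lambda>n. lpn q (s (r n) - l)) \<longlonglongrightarrow> 0"
    if "S \<subseteq> lpc q" "range s \<subseteq> S" "l \<in> S" for s l and r :: "nat \<Rightarrow> nat"
    using that limitin_lp_iff[OF assms, of "s \<circ> r" l] by (auto simp: comp_def)
  show ?thesis
    unfolding norm_topology_def Metric_space.compactin_sequentially[OF Metric_space_lp[OF assms]]
    unfolding norm_topology_def[symmetric] using eq by blast
qed

text \<open>
  The tails of a single vector tend to \<open>0\<close>, and a relatively compact set is finite up to a small error.
  The proof takes the sequential form of this: bad vectors \<open>x n\<close> for every \<open>n\<close> would have images
  converging along a subsequence to some \<open>l\<close>, whose tails are small.
\<close>

lemma compact_op_small_tails: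
  fixes K :: "(nat \<Rightarrow> 'a::real_normed_field) \<Rightarrow> nat \<Rightarrow> 'a"
  assumes q: "1 \<le> q" and K: "K \<in> compact_ops (lp p) (lp q)" and e: "0 < e"
  shows "\<exists>n. \<forall>x\<in>unit_ball (lp p). lpn q (restr {n..} (K x)) \<le> e"
proof (rule ccontr)
  assume "\<not> ?thesis"
  then obtain x where x: "\<And>n. x n \<in> unit_ball (lp p)" "\<And>n. e < lpn q (restr {n..} (K (x n)))"
    unfolding not_ex not_all Bex_def[symmetric] by (metis not_le)
  have Kop: "K \<in> opc p q"
    using K by (simp add: compact_ops_def)
  let ?S = "norm_topology (lp q) closure_of (K ` unit_ball (lp p))"
  have comp: "compactin (norm_topology (lp q)) ?S"
    using K by (simp add: compact_ops_def)
  have "K ` unit_ball (lp p) \<subseteq> topspace (norm_topology (lp q))"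
    using op_lpc[OF Kop] Metric_space.topspace_mtopology[OF Metric_space_lp[OF q]]
    by (auto simp: norm_topology_def unit_ball_lp_iff)
  then have "range (\<lambda>n. K (x n)) \<subseteq> ?S"
    using closure_of_subset x(1) by blast
  then obtain l r where l: "l \<in> lpc q" and r: "strict_mono r"
    and lim: "(\<lambda>n. lpn q (K (x (r n)) - l)) \<longlonglongrightarrow> 0"
    using comp unfolding compactin_lp_iff[OF q] by blast
  have "(\<lambda>n. lpn q (restr {r n..} l)) \<longlonglongrightarrow> 0"
    using LIMSEQ_subseq_LIMSEQ[OF lpn_restr_tail_tendsto_0[OF _ l] r] q by (simp add: comp_def)
  then have "(\<lambda>n. lpn q (K (x (r n)) - l) + lpn q (restr {r n..} l)) \<longlonglongrightarrow> 0"
    using tendsto_add[OF lim] by simp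
  then have "\<forall>\<^sub>F n in sequentially. lpn q (K (x (r n)) - l) + lpn q (restr {r n..} l) < e"
    using e by (rule order_tendstoD(2))
  then obtain n where n: "lpn q (K (x (r n)) - l) + lpn q (restr {r n..} l) < e"
    by (auto simp: eventually_sequentially)
  have Kx: "K (x (r n)) \<in> lpc q"
    using op_lpc[OF Kop] x(1) by (auto simp: unit_ball_lp_iff)
  have dl: "K (x (r n)) - l \<in> lpc q"
    using Kx l q by simp
  have "restr {r n..} (K (x (r n))) = restr {r n..} (K (x (r n)) - l) + restr {r n..} l"
    by (simp add: restr_diff)
  then have "lpn q (restr {r n..} (K (x (r n)))) \<le> lpn q (restr {r n..} (K (x (r n)) - l)) + lpn q (restr {r n..} l)"
    using lpn_triangle[OF q, of "restr {r n..} (K (x (r n)) - l)" "restr {r n..} l"] dl l q by simp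
  also have "\<dots> \<le> lpn q (K (x (r n)) - l) + lpn q (restr {r n..} l)"
    using lpn_restr_le[OF _ dl, of "{r n..}"] q by simp
  finally show False
    using n x(2)[of "r n"] by simp
qed

text \<open>
  On vectors supported in a fixed finite set, coordinatewise convergence is norm convergence.
\<close>

lemma compactin_finite_coordinates:
  fixes C :: real
  assumes q: "1 \<le> q" and E: "finite E"
  shows "compactin (norm_topology (lp q))
    {y :: nat \<Rightarrow> 'a::{real_normed_field, heine_borel}. restr E y = y \<and> (\<forall>i. norm (y i) \<le> C)}" (is "compactin _ ?F")
  unfolding compactin_lp_iff[OF q]
proof (intro conjI allI impI)
  have in': "y \<in> lpc q" if "restr E y = y" for y :: "nat \<Rightarrow> 'a"
    using lpn_restr_finite_le[OF q E, of y] that by simp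
  then show "?F \<subseteq> lpc q"
    by blast
  fix s :: "nat \<Rightarrow> nat \<Rightarrow> 'a"
  assume s: "range s \<subseteq> ?F"
  then have "norm (s n i) \<le> C" for n i
    by blast
  then obtain l r where r: "strict_mono r" and l: "\<And>i. (\<lambda>n. s (r n) i) \<longlonglongrightarrow> l i"
    using coordinatewise_convergent_subsequence[of s C] by blast
  have "norm (l i) \<le> C" for i
    using tendsto_norm[OF l[of i]] s by (intro LIMSEQ_le_const2[of "\<lambda>n. norm (s (r n) i)"]) auto
  moreover have "l i = 0" if "i \<notin> E" for i
  proof -
    have "restr E (s n) = s n" for n
      using s by blast
    then have "s n i = 0" for n
      using that restr_apply[of E "s n" i] by metis
    then show ?thesis
      using LIMSEQ_unique[OF l[of i], of 0] by simp
  qed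
  ultimately have lF: "l \<in> ?F"
    by (auto simp: restr_def)
  have "restr E (s (r n) - l) = s (r n) - l" for n
    using s lF by (auto simp: restr_diff)
  moreover have "(\<lambda>n. lpn q (restr E (s (r n) - l))) \<longlonglongrightarrow> 0"
    using l by (intro lpn_restr_finite_tendsto_0[OF q E]) (simp add: LIM_zero)
  ultimately have "(\<lambda>n. lpn q (s (r n) - l)) \<longlonglongrightarrow> 0"
    by simp
  then show "\<exists>l r. l \<in> ?F \<and> strict_mono (r::nat \<Rightarrow> nat) \<and> (\<lambda>n. lpn q (s (r n) - l)) \<longlonglongrightarrow> 0"
    using lF r by blast
qed

lemma finite_coordinates_compact_op:
  fixes T :: "(nat \<Rightarrow> 'a::{real_normed_field, heine_borel}) \<Rightarrow> nat \<Rightarrow> 'a"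
  assumes p: "0 < p" and q: "1 \<le> q" and E: "finite E" and T: "T \<in> opc p q"
  shows "(\<lambda>x. restr E (T x)) \<in> compact_ops (lp p) (lp q)"
proof -
  let ?F = "{y :: nat \<Rightarrow> 'a. restr E y = y \<and> (\<forall>i. norm (y i) \<le> opn p q T)}"
  have op: "(\<lambda>x. restr E (T x)) \<in> opc p q"
    using p q T by simp
  have comp: "compactin (norm_topology (lp q)) ?F"
    by (rule compactin_finite_coordinates[OF q E])
  have "(\<lambda>x. restr E (T x)) ` unit_ball (lp p) \<subseteq> ?F"
  proof safe
    fix x :: "nat \<Rightarrow> 'a" and i
    assume x: "x \<in> unit_ball (lp p)"
    show "restr E (restr E (T x)) = restr E (T x)"
      by (simp add: restr_restr)
    have "norm (restr E (T x) i) \<le> norm (T x i)"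
      by (simp add: restr_apply)
    also have "\<dots> \<le> lpn q (T x)"
      using x q op_lpc[OF T] by (intro norm_component_le_lpn) (auto simp: unit_ball_lp_iff)
    also have "\<dots> \<le> opn p q T"
      by (rule opn_ball[OF T x])
    finally show "norm (restr E (T x) i) \<le> opn p q T" .
  qed
  moreover have "closedin (norm_topology (lp q)) ?F"
    using compactin_imp_closedin[OF _ comp] Metric_space.Hausdorff_space_mtopology[OF Metric_space_lp[OF q]]
    by (simp add: norm_topology_def)
  ultimately have "norm_topology (lp q) closure_of ((\<lambda>x. restr E (T x)) ` unit_ball (lp p)) \<subseteq> ?F"
    by (rule closure_of_minimal)
  then have "compactin (norm_topology (lp q)) (norm_topology (lp q) closure_of ((\<lambda>x. restr E (T x)) ` unit_ball (lp p)))"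
    using closed_compactin[OF comp] closedin_closure_of by blast
  then show ?thesis
    using op by (simp add: compact_ops_def)
qed

text \<open>
  The truncations \<open>restr {..<n} \<circ> T\<close> are compact, which gives one direction. Conversely, if \<open>T\<close> is at
  distance less than \<open>c\<close> from a compact \<open>K\<close>, then cutting off the first \<open>n\<close> coordinates does not
  increase that distance and makes \<open>K\<close> negligible. So compactness enters the rest of the proof only
  through tails.
\<close>

lemma ess_norm_less_iff:
  fixes T :: "(nat \<Rightarrow> 'a::{real_normed_field, heine_borel}) \<Rightarrow> nat \<Rightarrow> 'a"
  assumes p: "0 < p" and q: "1 \<le> q" and T: "T \<in> opc p q"
  shows "ess_norm (lp p) (lp q) T < c \<longleftrightarrow> (\<exists>n. opn p q (\<lambda>x. restr {n..} (T x)) < c)"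
proof -
  have Kop: "K \<in> opc p q" if "K \<in> compact_ops (lp p) (lp q)" for K :: "(nat \<Rightarrow> 'a) \<Rightarrow> nat \<Rightarrow> 'a"
    using that by (simp add: compact_ops_def)
  have "bdd_below ((\<lambda>K. opn p q (T - K)) ` compact_ops (lp p) (lp q))"
    using p q T Kop by (intro bdd_belowI2[of _ 0] opn_nonneg op_minus) auto
  moreover have "compact_ops (lp p) (lp q) \<noteq> ({} :: ((nat \<Rightarrow> 'a) \<Rightarrow> nat \<Rightarrow> 'a) set)"
    using finite_coordinates_compact_op[OF p q _ T, of "{}"] by auto
  ultimately have iff: "ess_norm (lp p) (lp q) T < c \<longleftrightarrow> (\<exists>K\<in>compact_ops (lp p) (lp q). opn p q (T - K) < c)"
    unfolding ess_norm_def by (subst cINF_less_iff) auto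
  show ?thesis
    unfolding iff
  proof
    assume "\<exists>K\<in>compact_ops (lp p) (lp q). opn p q (T - K) < c"
    then obtain K where K: "K \<in> compact_ops (lp p) (lp q)" and less: "opn p q (T - K) < c"
      by blast
    then obtain n where n: "\<And>x. x \<in> unit_ball (lp p) \<Longrightarrow> lpn q (restr {n..} (K x)) \<le> (c - opn p q (T - K)) / 2"
      using compact_op_small_tails[OF q K, of "(c - opn p q (T - K)) / 2"] by auto
    have "opn p q (\<lambda>x. restr {n..} (T x)) \<le> opn p q (T - K) + (c - opn p q (T - K)) / 2"
    proof (rule opn_le)
      fix x :: "nat \<Rightarrow> 'a"
      assume x: "x \<in> unit_ball (lp p)"
      have TK: "T - K \<in> opc p q"
        using p q T Kop[OF K] by simp
      have in': "(T - K) x \<in> lpc q" "K x \<in> lpc q"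
        using x op_lpc[OF TK] op_lpc[OF Kop[OF K]] by (auto simp: unit_ball_lp_iff)
      have "restr {n..} (T x) = restr {n..} ((T - K) x) + restr {n..} (K x)"
        by (simp add: restr_diff)
      then have "lpn q (restr {n..} (T x)) \<le> lpn q (restr {n..} ((T - K) x)) + lpn q (restr {n..} (K x))"
        using lpn_triangle[OF q, of "restr {n..} ((T - K) x)" "restr {n..} (K x)"] in' q by simp
      also have "\<dots> \<le> lpn q ((T - K) x) + lpn q (restr {n..} (K x))"
        using lpn_restr_le[OF _ in'(1), of "{n..}"] q by simp
      also have "\<dots> \<le> opn p q (T - K) + (c - opn p q (T - K)) / 2"
        using opn_ball[OF TK x] n[OF x] by (rule add_mono)
      finally show "lpn q (restr {n..} (T x)) \<le> opn p q (T - K) + (c - opn p q (T - K)) / 2" .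
    qed
    then show "\<exists>n. opn p q (\<lambda>x. restr {n..} (T x)) < c"
      using less by (intro exI[of _ n]) (simp add: field_simps)
  next
    assume "\<exists>n. opn p q (\<lambda>x. restr {n..} (T x)) < c"
    then obtain n where n: "opn p q (\<lambda>x. restr {n..} (T x)) < c" ..
    have "T - (\<lambda>x. restr {..<n} (T x)) = (\<lambda>x. restr {n..} (T x))"
      by (auto simp: restr_def fun_eq_iff)
    then show "\<exists>K\<in>compact_ops (lp p) (lp q). opn p q (T - K) < c"
      using n finite_coordinates_compact_op[OF p q _ T, of "{..<n}"]
      by (intro bexI[of _ "\<lambda>x. restr {..<n} (T x)"]) simp_all
  qed
qed

section \<open>Maximizing sequences\<close>

lemma op_coordinate_functional:
  assumes "1 < p" "1 \<le> q" "T \<in> opc p q"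
  shows "lp_functional p (\<lambda>x. T x j) (opn p q T)"
proof
  fix x y :: "nat \<Rightarrow> 'a" and c
  assume x: "x \<in> lpc p"
  show "T (\<lambda>n. c * x n) j = c * T x j"
    using op_scale[OF assms(3) x] by simp
  have "norm (T x j) \<le> lpn q (T x)"
    using norm_component_le_lpn[OF _ op_lpc[OF assms(3) x]] assms by simp
  also have "\<dots> \<le> opn p q T * lpn p x"
    using opn_bound[of p q T x] x assms by simp
  finally show "norm (T x j) \<le> opn p q T * lpn p x" .
  assume y: "y \<in> lpc p"
  show "T (x + y) j = T x j + T y j"
    using op_add[OF assms(3) x y] by simp
qed (use assms in auto)

lemma op_tendsto_0_coordinatewise:
  assumes "1 < p" "1 \<le> q" "T \<in> opc p q"
    and "\<And>n. w n \<in> lpc p" "\<And>n. lpn p (w n) \<le> B" "\<And>i. (\<lambda>n. w n i) \<longlonglongrightarrow> 0"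
  shows "(\<lambda>n. T (w n) j) \<longlonglongrightarrow> 0"
  using lp_functional.tendsto_0_coordinatewise[OF op_coordinate_functional[OF assms(1-3)] assms(4-6)] .

text \<open>
  This is Delpech's argument for Pitt's theorem. For \<open>u\<close> in the unit ball and \<open>t > 0\<close>, compare the
  limits of both sides of \<open>\<parallel>T (u + t w n)\<parallel> \<le> \<parallel>u + t w n\<parallel>\<close>, as given by \<open>brezis_lieb\<close>. With the supremum
  over \<open>u\<close> this yields \<open>(t L)\<^sup>q \<le> (t b)\<^sup>p\<close>. Since \<open>q < p\<close>, this forces \<open>L = 0\<close> as \<open>t\<close> tends to \<open>0\<close>.
\<close>

lemma pitt_limit:
  fixes T :: "(nat \<Rightarrow> 'a::real_normed_field) \<Rightarrow> nat \<Rightarrow> 'a"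
  assumes q: "1 < q" and qp: "q < p" and T: "T \<in> opc p q" and T1: "opn p q T = 1"
    and w: "\<And>n. w n \<in> lpc p" "\<And>n. lpn p (w n) \<le> B" and 0: "\<And>i. (\<lambda>n. w n i) \<longlonglongrightarrow> 0"
    and b: "(\<lambda>n. lpn p (w n)) \<longlonglongrightarrow> b" and L: "(\<lambda>n. lpn q (T (w n))) \<longlonglongrightarrow> L"
  shows "L = 0"
proof (rule ccontr)
  assume "L \<noteq> 0"
  have nn: "0 \<le> b" "0 \<le> L"
    using LIMSEQ_le_const[OF b] LIMSEQ_le_const[OF L] by auto
  then have Lpos: "0 < L"
    using \<open>L \<noteq> 0\<close> by simp
  have p: "1 < p"
    using q qp by simp
  have Tw: "T (w n) \<in> lpc q" for n
    using op_lpc[OF T w(1)] .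
  have T0: "(\<lambda>n. T (w n) j) \<longlonglongrightarrow> 0" for j
    using op_tendsto_0_coordinatewise[OF p _ T w(1) w(2) 0] q by simp
  have key: "(t * L) powr q \<le> (t * b) powr p" if t: "0 < t" for t
  proof -
    have main: "lpn q (T u) powr q + (t * L) powr q \<le> 1 + (t * b) powr p" if u: "u \<in> unit_ball (lp p)" for u
    proof -
      define c where "c = (of_real t :: 'a)"
      have nc: "norm c = t"
        using t unfolding c_def norm_of_real by simp
      have u': "u \<in> lpc p" "lpn p u \<le> 1"
        using u by (auto simp: unit_ball_lp_iff)
      have cw: "(\<lambda>i. c * w n i) \<in> lpc p" for n
        using w by simp
      have Tcw: "T (u + (\<lambda>i. c * w n i)) = T u + (\<lambda>i. c * T (w n) i)" for n
        using op_add[OF T u'(1) cw] op_scale[OF T w(1)] by simp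
      have "(\<lambda>n. lpn p (\<lambda>i. c * w n i)) \<longlonglongrightarrow> t * b"
        using tendsto_mult[OF tendsto_const b, of t] lpn_scale[OF _ w(1), of c] p nc by simp
      then have 1: "(\<lambda>n. lpn p (u + (\<lambda>i. c * w n i))) \<longlonglongrightarrow> (lpn p u powr p + (t * b) powr p) powr (1 / p)"
        using p u' cw tendsto_mult[OF tendsto_const 0, of c] nn t by (intro brezis_lieb) auto
      have "(\<lambda>n. lpn q (\<lambda>i. c * T (w n) i)) \<longlonglongrightarrow> t * L"
        using tendsto_mult[OF tendsto_const L, of t] lpn_scale[OF _ Tw, of c] q nc by simp
      then have "(\<lambda>n. lpn q (T u + (\<lambda>i. c * T (w n) i))) \<longlonglongrightarrow> (lpn q (T u) powr q + (t * L) powr q) powr (1 / q)"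
        using q op_lpc[OF T u'(1)] Tw tendsto_mult[OF tendsto_const T0, of c] by (intro brezis_lieb) auto
      moreover have "lpn q (T u + (\<lambda>i. c * T (w n) i)) \<le> lpn p (u + (\<lambda>i. c * w n i))" for n
        using opn_bound[OF _ _ T, of "u + (\<lambda>i. c * w n i)"] u' cw p q T1 Tcw by simp
      ultimately have "(lpn q (T u) powr q + (t * L) powr q) powr (1 / q) \<le> (lpn p u powr p + (t * b) powr p) powr (1 / p)"
        using LIMSEQ_le 1 by blast
      then have "((lpn q (T u) powr q + (t * L) powr q) powr (1 / q)) powr q
          \<le> ((lpn p u powr p + (t * b) powr p) powr (1 / p)) powr q"
        using q by (intro powr_mono2) auto
      then have "lpn q (T u) powr q + (t * L) powr q \<le> (lpn p u powr p + (t * b) powr p) powr (q / p)"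
        using q p t nn by (simp add: powr_powr)
      also have "\<dots> \<le> (1 + (t * b) powr p) powr (q / p)"
        using u' p q t nn by (intro powr_mono2 add_mono powr_le1) auto
      also have "\<dots> \<le> (1 + (t * b) powr p) powr 1"
        using qp q by (intro powr_mono) auto
      finally show ?thesis
        by simp
    qed
    \<comment> \<open>\<open>X\<close> bounds the \<open>q\<close>-th power of
      \<open>\<parallel>T u\<parallel>\<close> for every \<open>u\<close>, hence that of the
      operator norm, which is \<open>1\<close>.\<close>
    define X where "X = 1 + (t * b) powr p - (t * L) powr q"
    have le: "lpn q (T u) powr q \<le> X" if "u \<in> unit_ball (lp p)" for u
      using main[OF that] by (simp add: X_def)
    have X: "0 \<le> X"
      using order_trans[OF powr_ge_zero le[OF zero_in_unit_ball]] .
    have "opn p q T \<le> X powr (1 / q)"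
    proof (rule opn_le)
      fix u :: "nat \<Rightarrow> 'a"
      assume "u \<in> unit_ball (lp p)"
      then have "(lpn q (T u) powr q) powr (1 / q) \<le> X powr (1 / q)"
        using le q by (intro powr_mono2) auto
      then show "lpn q (T u) \<le> X powr (1 / q)"
        using q by (simp add: powr_powr)
    qed
    then have "1 powr q \<le> (X powr (1 / q)) powr q"
      using T1 q by (intro powr_mono2) auto
    then show ?thesis
      using X q by (simp add: powr_powr X_def)
  qed
  have key': "L powr q \<le> t powr (p - q) * b powr p" if t: "0 < t" for t
  proof -
    have "t powr p = t powr q * t powr (p - q)"
      by (simp flip: powr_add)
    then have "t powr q * L powr q \<le> t powr q * (t powr (p - q) * b powr p)"
      using key[OF t] by (simp add: powr_mult mult.assoc)
    then show ?thesis
      using t by simp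
  qed
  have Lq: "0 < L powr q"
    using Lpos by simp
  moreover have "L powr q \<le> b powr p"
    using key'[of 1] by simp
  ultimately have bp: "0 < b powr p"
    by (rule less_le_trans)
  \<comment> \<open>Chosen such that the right-hand side of \<open>key'\<close> is half of its
    left-hand side.\<close>
  define t where "t = (L powr q / (2 * b powr p)) powr (1 / (p - q))"
  have "0 < t"
    using Lpos bp by (simp add: t_def)
  then have "L powr q \<le> t powr (p - q) * b powr p"
    by (rule key')
  also have "t powr (p - q) = L powr q / (2 * b powr p)"
    using qp Lq bp by (simp add: t_def powr_powr)
  finally show False
    using Lq bp by simp
qed

text \<open>
  Let \<open>b\<close> and \<open>L\<close> be the limits of \<open>\<parallel>w n\<parallel>\<close> and \<open>\<parallel>T (w n)\<parallel>\<close>, where \<open>w n\<close> is the difference to the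
  coordinatewise limit \<open>z\<close>. Then \<open>\<parallel>z\<parallel>\<^sup>p + b\<^sup>p \<le> 1\<close> and \<open>\<parallel>T z\<parallel>\<^sup>q + L\<^sup>q = 1\<close>, and \<open>b = 0\<close> is the claim. For
  \<open>q < p\<close>, \<open>L = 0\<close> by \<open>pitt_limit\<close> and \<open>z\<close> has norm \<open>1\<close>. For \<open>p \<le> q\<close>, the essential norm gives
  \<open>L \<le> c b\<close> with \<open>c < 1\<close>, so that \<open>b > 0\<close> would imply \<open>\<parallel>T z\<parallel>\<^sup>q + L\<^sup>q < \<parallel>z\<parallel>\<^sup>p + b\<^sup>p\<close>.
\<close>

lemma maximizing_sequence_converges:
  fixes T :: "(nat \<Rightarrow> 'a::{real_normed_field, heine_borel}) \<Rightarrow> nat \<Rightarrow> 'a"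
  assumes p: "1 < p" and q: "1 < q" and T: "T \<in> opc p q" and T1: "opn p q T = 1"
    and ess: "ess_norm (lp p) (lp q) T < 1"
    and x: "\<And>n. x n \<in> unit_ball (lp p)" and lim: "(\<lambda>n. lpn q (T (x n))) \<longlonglongrightarrow> 1"
  shows "\<exists>z\<in>unit_ball (lp p). \<exists>r. strict_mono (r::nat \<Rightarrow> nat) \<and> (\<lambda>n. lpn p (x (r n) - z)) \<longlonglongrightarrow> 0"
proof -
  have p0: "0 < p" "1 \<le> p" and q0: "0 < q" "1 \<le> q"
    using p q by auto
  have x': "x n \<in> lpc p" "lpn p (x n) \<le> 1" for n
    using x by (auto simp: unit_ball_lp_iff)
  have "norm (x n i) \<le> 1" for n i
    using norm_component_le_lpn[OF p0(1) x'(1)] x'(2) order_trans by blast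
  then obtain z r1 where r1: "strict_mono r1" and z0: "\<And>i. (\<lambda>n. x (r1 n) i) \<longlonglongrightarrow> z i"
    using coordinatewise_convergent_subsequence[of x 1] by blast
  have "(\<Sum>i<k. norm (z i) powr p) \<le> 1 powr p" for k
  proof (rule LIMSEQ_le_const2)
    show "(\<lambda>n. \<Sum>i<k. norm (x (r1 n) i) powr p) \<longlonglongrightarrow> (\<Sum>i<k. norm (z i) powr p)"
      using p0 by (intro tendsto_sum tendsto_powr' tendsto_norm z0 tendsto_const) auto
    show "\<exists>N. \<forall>n\<ge>N. (\<Sum>i<k. norm (x (r1 n) i) powr p) \<le> 1 powr p"
      using lpc_lpn_le_iff[OF p0(1), of 1] x' by auto
  qed
  then have z: "z \<in> lpc p" "lpn p z \<le> 1"
    using lpc_lpn_le_iff[OF p0(1), of 1 z] by auto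
  define w where "w n = x (r1 n) - z" for n
  have w: "w n \<in> lpc p" "lpn p (w n) \<le> 2" for n
    using x'(1)[of "r1 n"] x'(2)[of "r1 n"] z lpn_triangle_diff[OF p0(2), of "x (r1 n)" z] p0
    by (auto simp: w_def)
  have Tw: "T (w n) \<in> lpc q" "lpn q (T (w n)) \<le> 2" for n
    using op_lpc[OF T w(1)] opn_bound[OF p0(1) q0(1) T w(1), of n] w(2)[of n] T1 by auto
  have "bounded (range (\<lambda>n. (lpn p (w n), lpn q (T (w n)))))"
  proof (rule bounded_subset)
    show "bounded ({0..2::real} \<times> {0..2::real})"
      by (intro bounded_Times bounded_closed_interval)
  qed (use w Tw in auto)
  then obtain bL and r2 :: "nat \<Rightarrow> nat" where r2: "strict_mono r2"
    and bL: "((\<lambda>n. (lpn p (w n), lpn q (T (w n)))) \<circ> r2) \<longlonglongrightarrow> bL"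
    using bounded_imp_convergent_subsequence by blast
  obtain b L where bL': "bL = (b, L)"
    by force
  define W where "W n = w (r2 n)" for n
  have b: "(\<lambda>n. lpn p (W n)) \<longlonglongrightarrow> b" and L: "(\<lambda>n. lpn q (T (W n))) \<longlonglongrightarrow> L"
    using tendsto_fst[OF bL] tendsto_snd[OF bL] by (simp_all add: bL' W_def comp_def)
  have nn: "0 \<le> b" "0 \<le> L"
    using LIMSEQ_le_const[OF b] LIMSEQ_le_const[OF L] by auto
  have W: "W n \<in> lpc p" "lpn p (W n) \<le> 2" for n
    using w by (auto simp: W_def)
  have W0: "(\<lambda>n. W n i) \<longlonglongrightarrow> 0" for i
    using LIMSEQ_subseq_LIMSEQ[OF LIM_zero[OF z0[of i]] r2] by (simp add: W_def w_def comp_def)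
  have TW0: "(\<lambda>n. T (W n) j) \<longlonglongrightarrow> 0" for j
    using op_tendsto_0_coordinatewise[OF p q0(2) T W W0] .
  have zW: "z + W n = x ((r1 \<circ> r2) n)" for n
    by (simp add: W_def w_def)
  have r: "strict_mono (r1 \<circ> r2)"
    using r1 r2 by (rule strict_mono_o)
  have "(\<lambda>n. lpn p (z + W n)) \<longlonglongrightarrow> (lpn p z powr p + b powr p) powr (1 / p)"
    by (rule brezis_lieb[OF p0(2) z(1) W(1) W0 b])
  then have "(lpn p z powr p + b powr p) powr (1 / p) \<le> 1"
    by (rule LIMSEQ_le_const2) (use zW x' in auto)
  then have "((lpn p z powr p + b powr p) powr (1 / p)) powr p \<le> 1"
    using p by (intro powr_le1) auto
  then have dom: "lpn p z powr p + b powr p \<le> 1"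
    using p by (simp add: powr_powr)
  have "(\<lambda>n. lpn q (T z + T (W n))) \<longlonglongrightarrow> (lpn q (T z) powr q + L powr q) powr (1 / q)"
    using op_lpc[OF T] z(1) W(1) by (intro brezis_lieb[OF q0(2) _ _ TW0 L]) auto
  moreover have "T z + T (W n) = T (x ((r1 \<circ> r2) n))" for n
    using op_add[OF T z(1) W(1)] zW by simp
  moreover have "(\<lambda>n. lpn q (T (x ((r1 \<circ> r2) n)))) \<longlonglongrightarrow> 1"
    using LIMSEQ_subseq_LIMSEQ[OF lim r] by (simp add: comp_def)
  ultimately have "(lpn q (T z) powr q + L powr q) powr (1 / q) = 1"
    using LIMSEQ_unique by simp
  then have "((lpn q (T z) powr q + L powr q) powr (1 / q)) powr q = 1"
    by simp
  then have ran: "lpn q (T z) powr q + L powr q = 1"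
    using q by (simp add: powr_powr)
  have Tz: "lpn q (T z) \<le> lpn p z"
    using opn_bound[OF p0(1) q0(1) T z(1)] T1 by simp
  have "b = 0"
  proof (rule ccontr)
    assume "b \<noteq> 0"
    then have bpos: "0 < b powr p"
      by simp
    show False
    proof (cases "q < p")
      case True
      then have "L = 0"
        using pitt_limit[OF q _ T T1 W W0 b L] by simp
      then have "(lpn q (T z) powr q) powr (1 / q) = 1"
        using ran by simp
      then have "lpn q (T z) = 1"
        using q by (simp add: powr_powr)
      then have "1 powr p \<le> lpn p z powr p"
        using Tz p by (intro powr_mono2) auto
      then show False
        using dom bpos by simp
    next
      case False
      obtain m where m: "opn p q (\<lambda>x. restr {m..} (T x)) < 1"
        using ess ess_norm_less_iff[OF p0(1) q0(2) T] by blast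
      define c where "c = opn p q (\<lambda>x. restr {m..} (T x))"
      have Rop: "(\<lambda>x. restr {m..} (T x)) \<in> opc p q"
        using op_restr[OF p0(1) q0(1) T] .
      have c: "0 \<le> c" "c < 1"
        using m opn_nonneg[OF Rop] by (auto simp: c_def)
      have "lpn q (T (W n)) \<le> lpn q (restr {..<m} (T (W n))) + c * lpn p (W n)" for n
      proof -
        have "T (W n) = restr {..<m} (T (W n)) + restr {m..} (T (W n))"
          by (auto simp: restr_def fun_eq_iff)
        then have "lpn q (T (W n)) \<le> lpn q (restr {..<m} (T (W n))) + lpn q (restr {m..} (T (W n)))"
          using lpn_triangle[OF q0(2), of "restr {..<m} (T (W n))" "restr {m..} (T (W n))"]
            op_lpc[OF T W(1)] q0 by simp
        then show ?thesis
          using opn_bound[OF p0(1) q0(1) Rop W(1), of n] by (simp add: c_def)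
      qed
      moreover have "(\<lambda>n. lpn q (restr {..<m} (T (W n))) + c * lpn p (W n)) \<longlonglongrightarrow> 0 + c * b"
        using TW0 by (intro tendsto_add tendsto_mult tendsto_const b lpn_restr_finite_tendsto_0[OF q0(2)]) auto
      ultimately have Lc: "L \<le> c * b"
        using LIMSEQ_le[OF L] by fastforce
      have b1: "b powr p \<le> 1 powr p"
        using dom by (smt (verit) powr_ge_zero powr_one_eq_one)
      then have b1: "b \<le> 1"
        using p by (intro powr_le_powr_cancel[of p 1 b]) auto
      have "c * b < b"
        using c nn \<open>b \<noteq> 0\<close> by (simp add: mult_less_cancel_right2)
      then have "L < b"
        using Lc by simp
      then have "L powr q < b powr q"
        using nn q by (intro powr_less_mono2) auto
      also have "\<dots> \<le> b powr p"
        using False nn b1 by (intro powr_mono') auto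
      finally have "L powr q < b powr p" .
      moreover have "lpn q (T z) powr q \<le> lpn p z powr q"
        using Tz q by (intro powr_mono2) auto
      moreover have "lpn p z powr q \<le> lpn p z powr p"
        using False z by (intro powr_mono') auto
      ultimately show False
        using dom ran by linarith
    qed
  qed
  then have "(\<lambda>n. lpn p (x ((r1 \<circ> r2) n) - z)) \<longlonglongrightarrow> 0"
    using b by (simp add: W_def w_def)
  then show ?thesis
    using z r unfolding unit_ball_lp_iff Bex_def by blast
qed

section \<open>Smoothness of the norm of the range space\<close>

lemma abs_inner_one_le: "\<bar>z \<bullet> 1\<bar> \<le> norm (z :: 'a::{real_normed_field, real_inner})"
  using Cauchy_Schwarz_ineq2[of z 1] by simp

text \<open>
  For small \<open>z\<close> the term \<open>e * norm z\<close> absorbs the error of the first-order expansion of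
  \<open>(1 + 2 Re z + \<bar>z\<bar>\<^sup>2)\<^bsup>q/2\<^esup>\<close>; for the remaining \<open>z\<close> everything is at most a multiple of \<open>\<bar>z\<bar>\<^sup>q\<close>.
\<close>

lemma norm_one_plus_powr_le:
  fixes q e :: real
  assumes q: "1 < q" and e: "0 < e"
  shows "\<exists>C\<ge>1. \<forall>z::'a::{real_normed_field, real_inner}.
    norm (1 + z) powr q \<le> 1 + q * (z \<bullet> 1) + e * norm z + C * norm z powr q"
proof -
  have "((\<lambda>u::real. (1 + u) powr (q / 2)) has_field_derivative q / 2) (at 0)"
    by (auto intro!: derivative_eq_intros)
  moreover have "0 < e / 6"
    using e by simp
  ultimately have "\<exists>d>0. \<forall>u::real. norm (u - 0) < d \<longrightarrow>
      norm ((1 + u) powr (q / 2) - (1 + 0) powr (q / 2) - q / 2 * (u - 0)) \<le> e / 6 * norm (u - 0)"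
    unfolding has_field_derivative_def has_derivative_at_alt by blast
  then obtain d where d: "0 < d"
    and der: "\<And>u::real. \<bar>u\<bar> < d \<Longrightarrow> \<bar>(1 + u) powr (q / 2) - 1 - q / 2 * u\<bar> \<le> e / 6 * \<bar>u\<bar>"
    by (simp only: diff_zero add_0_right powr_one_eq_one real_norm_def) blast
  \<comment> \<open>For \<open>norm z < \<delta>\<close> the increment \<open>2 Re z +
    \<bar>z\<bar>\<^sup>2\<close> has absolute value at most \<open>3 * norm z < d\<close>, and
    its quadratic part contributes at most \<open>e / 2 * norm z\<close>.\<close>
  define \<delta> where "\<delta> = min 1 (min (d / 4) (e / q))"
  have "\<delta> \<le> e / q"
    by (simp add: \<delta>_def)
  then have "q * \<delta> \<le> e"
    using q by (simp add: pos_le_divide_eq mult.commute)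
  moreover have "\<delta> \<le> d / 4" "0 < \<delta>"
    using d e q unfolding \<delta>_def by (auto simp only: min.cobounded1 min.cobounded2 min.coboundedI2
      min_less_iff_conj intro: divide_pos_pos)
  ultimately have del: "0 < \<delta>" "\<delta> \<le> 1" "\<delta> \<le> d / 4" "q * \<delta> \<le> e"
    by (auto simp: \<delta>_def)
  define C where "C = 1 + (1 / \<delta> + 1) powr q + q * \<delta> * (1 / \<delta>) powr q"
  have C: "1 \<le> C"
    using q del by (simp add: C_def)
  have "norm (1 + z) powr q \<le> 1 + q * (z \<bullet> 1) + e * norm z + C * norm z powr q" for z :: 'a
  proof (cases "norm z < \<delta>")
    case True
    define u where "u = 2 * (z \<bullet> 1) + (norm z)\<^sup>2"
    have zz: "(norm z)\<^sup>2 \<le> \<delta> * norm z"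
      using True by (simp add: power2_eq_square mult_right_mono)
    then have zz1: "(norm z)\<^sup>2 \<le> norm z"
      using del(2) mult_right_mono[of \<delta> 1 "norm z"] by simp
    have u: "\<bar>u\<bar> \<le> 3 * norm z"
      using abs_inner_one_le[of z] zz1 zero_le_power2[of "norm z"] unfolding u_def by linarith
    have "(norm (1 + z))\<^sup>2 = 1 + u"
      using power2_norm_eq_inner[of "1 :: 'a"]
      by (simp add: power2_norm_eq_inner u_def inner_add_left inner_add_right inner_commute)
    then have "norm (1 + z) powr q = (1 + u) powr (q / 2)"
      using powr_powr[of "norm (1 + z)" 2 "q / 2"] by simp
    also have "\<dots> \<le> 1 + q / 2 * u + e / 6 * \<bar>u\<bar>"
      using der[of u] u True del by linarith
    also have "\<dots> \<le> 1 + q / 2 * u + e / 6 * (3 * norm z)"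
      using u e by (intro add_left_mono mult_left_mono) auto
    also have "\<dots> = 1 + q * (z \<bullet> 1) + q / 2 * (norm z)\<^sup>2 + e / 2 * norm z"
      by (simp add: u_def algebra_simps)
    also have "q / 2 * (norm z)\<^sup>2 \<le> q / 2 * (\<delta> * norm z)"
      using zz q by (intro mult_left_mono) auto
    also have "q / 2 * (\<delta> * norm z) \<le> e / 2 * norm z"
      using mult_right_mono[OF del(4), of "norm z"] by simp
    finally have "norm (1 + z) powr q \<le> 1 + q * (z \<bullet> 1) + e * norm z"
      by simp
    moreover have "0 \<le> C * norm z powr q"
      using C by simp
    ultimately show ?thesis
      by linarith
  next
    case False
    then have z: "1 \<le> norm z / \<delta>"
      using del by (simp add: field_simps)
    have "norm (1 + z) \<le> 1 + norm z"
      using norm_triangle_ineq[of 1 z] by simp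
    also have "\<dots> \<le> (1 / \<delta> + 1) * norm z"
      using z by (simp add: distrib_right)
    finally have "norm (1 + z) powr q \<le> ((1 / \<delta> + 1) * norm z) powr q"
      using q by (intro powr_mono2) auto
    then have 1: "norm (1 + z) powr q \<le> (1 / \<delta> + 1) powr q * norm z powr q"
      by (simp add: powr_mult)
    have "norm z / \<delta> \<le> (norm z / \<delta>) powr q"
      using powr_mono[of 1 q "norm z / \<delta>"] z q del by simp
    then have "q * \<delta> * (norm z / \<delta>) \<le> q * \<delta> * (norm z / \<delta>) powr q"
      using q del by (intro mult_left_mono) auto
    then have 2: "q * norm z \<le> q * \<delta> * (1 / \<delta>) powr q * norm z powr q"
      using del by (simp add: powr_divide)
    have "\<bar>q * (z \<bullet> 1)\<bar> \<le> q * norm z"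
      using abs_inner_one_le[of z] q by (simp add: abs_mult)
    moreover have "0 \<le> e * norm z" "0 \<le> norm z powr q"
      using e by auto
    ultimately show ?thesis
      using 1 2 unfolding C_def distrib_right by linarith
  qed
  then show ?thesis
    using C
    by blast
qed

text \<open>
  The previous inequality, scaled by \<open>a\<close>. For \<open>a = 0\<close> the terms with \<open>b / a\<close> vanish, which is why
  \<open>C\<close> is required to be at least \<open>1\<close>.
\<close>

lemma norm_add_powr_le:
  fixes q e :: real
  assumes q: "1 < q" and e: "0 < e"
  shows "\<exists>C\<ge>1. \<forall>a b::'a::{real_normed_field, real_inner}.
    norm (a + b) powr q \<le> norm a powr q + q * (norm a powr q * ((b / a) \<bullet> 1))
      + e * (norm a powr q * norm (b / a)) + C * norm b powr q"
proof -
  obtain C where C: "1 \<le> C" and le: "\<And>z::'a. norm (1 + z) powr q \<le> 1 + q * (z \<bullet> 1) + e * norm z + C * norm z powr q"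
    using norm_one_plus_powr_le[OF assms] by blast
  have "norm (a + b) powr q \<le> norm a powr q + q * (norm a powr q * ((b / a) \<bullet> 1))
      + e * (norm a powr q * norm (b / a)) + C * norm b powr q" for a b :: 'a
  proof (cases "a = 0")
    case True
    then show ?thesis
      using mult_right_mono[OF C, of "norm b powr q"] by simp
  next
    case False
    then have "a + b = a * (1 + b / a)"
      by (simp add: distrib_left)
    then have "norm (a + b) powr q = norm a powr q * norm (1 + b / a) powr q"
      by (simp only: norm_mult powr_mult)
    also have "\<dots> \<le> norm a powr q * (1 + q * ((b / a) \<bullet> 1) + e * norm (b / a) + C * norm (b / a) powr q)"
      by (intro mult_left_mono le) auto
    also have "\<dots> = norm a powr q + q * (norm a powr q * ((b / a) \<bullet> 1))
      + e * (norm a powr q * norm (b / a)) + C * (norm a powr q * norm (b / a) powr q)"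
      by (simp add: algebra_simps)
    also have "norm a powr q * norm (b / a) powr q = norm b powr q"
      using False by (simp add: norm_divide powr_divide)
    finally show ?thesis .
  qed
  then show ?thesis
    using C by blast
qed

text \<open>
  At a unit vector \<open>y\<close>, this is the functional whose real part is the derivative of the norm of \<open>\<ell>\<^sub>q\<close>;
  its usual form is \<open>\<Sum>n. \<bar>y\<^sub>n\<bar>\<^bsup>q - 2\<^esup> cnj y\<^sub>n v\<^sub>n\<close>. Since \<open>\<bar>a\<bar>\<^sup>2 / a\<close> is the conjugate of \<open>a\<close>, division
  expresses it for both scalar fields. Terms with \<open>y\<^sub>n = 0\<close> are \<open>0\<close>, as they should be.
\<close>

definition lq_gradient :: "real \<Rightarrow> (nat \<Rightarrow> 'a) \<Rightarrow> (nat \<Rightarrow> 'a) \<Rightarrow> 'a::real_normed_field" where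
  "lq_gradient q y v = (\<Sum>n. norm (y n) powr q *\<^sub>R (v n / y n))"

text \<open>
  The left-hand side is \<open>\<bar>a\<bar>\<^bsup>q - 1\<^esup> \<bar>b\<bar>\<close>, at most the \<open>q\<close>-th power of the larger of \<open>\<bar>a\<bar>\<close> and \<open>\<bar>b\<bar>\<close>. This crude
  substitute for Hoelder's inequality costs a factor \<open>2\<close> in \<open>norm_lq_gradient_le\<close>.
\<close>

lemma norm_gradient_term_le:
  fixes a b :: "'a::real_normed_field"
  assumes "1 < q"
  shows "norm a powr q * norm (b / a) \<le> norm a powr q + norm b powr q"
proof (cases "norm b \<le> norm a \<or> a = 0")
  case True
  then have "norm (b / a) \<le> 1"
    by (auto simp: norm_divide divide_le_eq_1)
  then show ?thesis
    using mult_left_le[OF _ powr_ge_zero, of "norm (b / a)" "norm a" q] powr_ge_zero[of "norm b" q]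
    by linarith
next
  case False
  then have "1 \<le> norm b / norm a"
    by (auto simp: field_simps)
  then have "norm b / norm a \<le> (norm b / norm a) powr q"
    using powr_mono[of 1 q "norm b / norm a"] assms by simp
  then have "norm a powr q * (norm b / norm a) \<le> norm a powr q * (norm b / norm a) powr q"
    by (intro mult_left_mono) auto
  also have "\<dots> = norm b powr q"
    using False by (simp add: powr_divide)
  finally show ?thesis
    by (simp add: norm_divide add_increasing)
qed

context
  fixes q :: real and y :: "nat \<Rightarrow> 'a::{real_normed_field, banach}"
  assumes q: "1 < q" and y: "y \<in> lpc q"
begin

lemma exponent_pos: "0 < q" "1 \<le> q"
  using q by auto

lemma summable_norm_gradient:
  assumes "v \<in> lpc q"
  shows "summable (\<lambda>n. norm (y n) powr q * norm (v n / y n))"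
proof (rule summable_comparison_test')
  show "summable (\<lambda>n. norm (y n) powr q + norm (v n) powr q)"
    using y assms by (simp add: lpc_iff summable_add)
  show "norm (norm (y n) powr q * norm (v n / y n)) \<le> norm (y n) powr q + norm (v n) powr q"
    if "0 \<le> n" for n
    using norm_gradient_term_le[OF q, of "y n" "v n"] by (simp only: real_norm_def abs_mult abs_norm_cancel powr_ge_zero abs_of_nonneg)
qed

lemma suminf_norm_gradient_le:
  assumes "v \<in> lpc q"
  shows "(\<Sum>n. norm (y n) powr q * norm (v n / y n)) \<le> lpn q y powr q + lpn q v powr q"
proof -
  have "(\<Sum>n. norm (y n) powr q * norm (v n / y n)) \<le> (\<Sum>n. norm (y n) powr q + norm (v n) powr q)"
    using y assms
    by (intro suminf_le norm_gradient_term_le[OF q] summable_norm_gradient summable_add) (simp_all add: lpc_iff)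
  also have "\<dots> = lpn q y powr q + lpn q v powr q"
    using y assms exponent_pos by (subst suminf_add[symmetric]) (auto simp: lpn_powr simp flip: lpc_iff)
  finally show ?thesis .
qed

lemma summable_gradient:
  assumes "v \<in> lpc q"
  shows "summable (\<lambda>n. norm (y n) powr q *\<^sub>R (v n / y n))"
proof (rule summable_norm_cancel)
  have "norm (norm (y n) powr q *\<^sub>R (v n / y n)) = norm (y n) powr q * norm (v n / y n)" for n
    by simp
  then show "summable (\<lambda>n. norm (norm (y n) powr q *\<^sub>R (v n / y n)))"
    using summable_norm_gradient[OF assms] by presburger
qed

lemma lq_gradient_add:
  assumes "u \<in> lpc q" "v \<in> lpc q"
  shows "lq_gradient q y (u + v) = lq_gradient q y u + lq_gradient q y v"
  unfolding lq_gradient_def suminf_add[OF summable_gradient[OF assms(1)] summable_gradient[OF assms(2)]]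
  by (simp add: add_divide_distrib scaleR_add_right)

lemma lq_gradient_scale:
  assumes "v \<in> lpc q"
  shows "lq_gradient q y (\<lambda>n. c * v n) = c * lq_gradient q y v"
  unfolding lq_gradient_def suminf_mult[OF summable_gradient[OF assms], symmetric]
  by simp

lemma norm_lq_gradient_le:
  assumes v: "v \<in> lpc q" and y1: "lpn q y = 1"
  shows "norm (lq_gradient q y v) \<le> 2 * lpn q v"
proof (cases "lpn q v = 0")
  case True
  then have "v = 0"
    using lpn_eq_0D[OF exponent_pos(1) v] by simp
  then show ?thesis
    by (simp add: lq_gradient_def)
next
  case False
  have unit: "norm (lq_gradient q y w) \<le> 2" if w: "w \<in> lpc q" "lpn q w \<le> 1" for w
  proof -
    have "norm (lq_gradient q y w) \<le> (\<Sum>n. norm (norm (y n) powr q *\<^sub>R (w n / y n)))"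
      unfolding lq_gradient_def
    proof (rule summable_norm)
      have "norm (norm (y n) powr q *\<^sub>R (w n / y n)) = norm (y n) powr q * norm (w n / y n)" for n
        by simp
      then show "summable (\<lambda>n. norm (norm (y n) powr q *\<^sub>R (w n / y n)))"
        using summable_norm_gradient[OF w(1)] by presburger
    qed
    also have "\<dots> \<le> lpn q y powr q + lpn q w powr q"
      using suminf_norm_gradient_le[OF w(1)] by simp
    also have "\<dots> \<le> 2"
      using y1 powr_le1[of q "lpn q w"] w exponent_pos by simp
    finally show ?thesis .
  qed
  define c where "c = (of_real (1 / lpn q v) :: 'a)"
  have pos: "0 < lpn q v"
    using False lpn_nonneg[of q v] by linarith
  have nc: "norm c = 1 / lpn q v"
    unfolding c_def norm_of_real using pos by simp
  have "norm (lq_gradient q y (\<lambda>n. c * v n)) \<le> 2"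
    using lpn_scale[OF exponent_pos(1) v, of c] nc pos lpc_scale[OF v] by (intro unit) auto
  then have "1 / lpn q v * norm (lq_gradient q y v) \<le> 2"
    by (simp add: lq_gradient_scale[OF v] norm_mult nc)
  then show ?thesis
    using pos by (simp add: field_simps)
qed

end

lemma bernoulli_powr_le:
  fixes a X r :: real
  assumes "1 < a" "0 \<le> X" "X \<le> 1 + a * r"
  shows "X powr (1 / a) \<le> 1 + r"
proof (cases "1 + a * r = 0")
  case True
  then have "r = - 1 / a" "X = 0"
    using assms by (auto simp: field_simps)
  then show ?thesis
    using assms by simp
next
  case False
  then have pos: "0 < 1 + a * r"
    using assms by linarith
  have "X powr (1 / a) \<le> (1 + a * r) powr (1 / a)"
    using assms by (intro powr_mono2) auto
  also have "\<dots> \<le> 1 / a * (1 + a * r) + (1 - 1 / a) * 1"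
    using Youngs_inequality_0[of "1 / a" "1 - 1 / a" "1 + a * r" 1] assms pos by simp
  also have "\<dots> = 1 + r"
    using assms by (simp add: field_simps)
  finally show ?thesis .
qed

text \<open>
  Sum \<open>norm_add_powr_le\<close> over the coordinates and take the \<open>q\<close>-th root with Bernoulli's inequality. An
  upper estimate suffices: by convexity of the norm it implies the matching lower estimate, with \<open>t\<close>
  replaced by \<open>- t\<close>.
\<close>

lemma lq_norm_smooth_upper:
  fixes y :: "nat \<Rightarrow> 'a::{real_normed_field, real_inner, banach}"
  assumes q: "1 < q" and y: "y \<in> lpc q" and y1: "lpn q y = 1" and e: "0 < e"
  shows "\<exists>s>0. \<forall>v\<in>unit_ball (lp q). \<forall>t. \<bar>t\<bar> \<le> s \<longrightarrow>
    lpn q (y + (\<lambda>n. of_real t * v n)) \<le> 1 + t * (lq_gradient q y v \<bullet> 1) + e * \<bar>t\<bar>"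
proof -
  have q0: "0 < q" "1 \<le> q"
    using q by auto
  obtain C where C: "1 \<le> C" and le: "\<And>a b::'a. norm (a + b) powr q
      \<le> norm a powr q + q * (norm a powr q * ((b / a) \<bullet> 1)) + q * e / 4 * (norm a powr q * norm (b / a)) + C * norm b powr q"
    using norm_add_powr_le[OF q, of "q * e / 4"] e q by auto
  \<comment> \<open>Chosen such that \<open>C * \<bar>t\<bar> powr q\<close> is at most \<open>q
    * e / 2 * \<bar>t\<bar>\<close> for \<open>\<bar>t\<bar> \<le> s\<close>.\<close>
  define s where "s = (q * e / (2 * C)) powr (1 / (q - 1))"
  have s: "0 < s"
    using q e C by (simp add: s_def)
  have sC: "C * s powr (q - 1) = q * e / 2"
    using q e C by (simp add: s_def powr_powr)
  have "lpn q (y + (\<lambda>n. of_real t * v n)) \<le> 1 + t * (lq_gradient q y v \<bullet> 1) + e * \<bar>t\<bar>"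
    if v: "v \<in> unit_ball (lp q)" and t: "\<bar>t\<bar> \<le> s" for v :: "nat \<Rightarrow> 'a" and t
  proof -
    have v': "v \<in> lpc q" "lpn q v \<le> 1"
      using v by (auto simp: unit_ball_lp_iff)
    have tv: "(\<lambda>n. of_real t * v n) \<in> lpc q"
      using v' by simp
    have in': "y + (\<lambda>n. of_real t * v n) \<in> lpc q"
      using y tv q0 by simp
    have vq: "lpn q v powr q \<le> 1"
      using v' q0 by (intro powr_le1) auto
    have S1: "summable (\<lambda>n. norm (y n) powr q)" and S4: "summable (\<lambda>n. norm (v n) powr q)"
      using y v' by (simp_all add: lpc_iff)
    have bl: "bounded_linear (\<lambda>z::'a. z \<bullet> 1)"
      by (rule bounded_linear_inner_left)
    have S2: "summable (\<lambda>n. norm (y n) powr q * ((v n / y n) \<bullet> 1))"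
      using bounded_linear.summable[OF bl summable_gradient[OF q y v'(1)]] by simp
    have eq2: "(\<Sum>n. norm (y n) powr q * ((v n / y n) \<bullet> 1)) = lq_gradient q y v \<bullet> 1"
      using bounded_linear.suminf[OF bl summable_gradient[OF q y v'(1)]] by (simp add: lq_gradient_def)
    have S3: "summable (\<lambda>n. norm (y n) powr q * norm (v n / y n))"
      by (rule summable_norm_gradient[OF q y v'(1)])
    have pointwise: "norm (y n + of_real t * v n) powr q \<le> norm (y n) powr q
      + q * t * (norm (y n) powr q * ((v n / y n) \<bullet> 1))
      + q * e / 4 * \<bar>t\<bar> * (norm (y n) powr q * norm (v n / y n))
      + C * \<bar>t\<bar> powr q * norm (v n) powr q" for n
    proof -
      have "of_real t * v n / y n = t *\<^sub>R (v n / y n)"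
        by (simp add: scaleR_conv_of_real)
      then show ?thesis
        using le[of "y n" "of_real t * v n"] by (simp add: norm_mult powr_mult mult_ac)
    qed
    have "lpn q (y + (\<lambda>n. of_real t * v n)) powr q = (\<Sum>n. norm (y n + of_real t * v n) powr q)"
      using in' q0 by (simp add: lpn_powr)
    also have "\<dots> \<le> (\<Sum>n. norm (y n) powr q
      + q * t * (norm (y n) powr q * ((v n / y n) \<bullet> 1))
      + q * e / 4 * \<bar>t\<bar> * (norm (y n) powr q * norm (v n / y n))
      + C * \<bar>t\<bar> powr q * norm (v n) powr q)"
      using in' by (intro suminf_le pointwise summable_add summable_mult S1 S2 S3 S4) (simp add: lpc_iff)
    also have "\<dots> = (\<Sum>n. norm (y n) powr q)
      + q * t * (\<Sum>n. norm (y n) powr q * ((v n / y n) \<bullet> 1))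
      + q * e / 4 * \<bar>t\<bar> * (\<Sum>n. norm (y n) powr q * norm (v n / y n))
      + C * \<bar>t\<bar> powr q * (\<Sum>n. norm (v n) powr q)"
      by (simp only: suminf_add[symmetric] suminf_mult summable_add summable_mult S1 S2 S3 S4)
    also have "\<dots> \<le> 1 + q * t * (lq_gradient q y v \<bullet> 1) + q * e / 4 * \<bar>t\<bar> * 2 + q * e / 2 * \<bar>t\<bar> * 1"
    proof -
      have "(\<Sum>n. norm (y n) powr q) = 1"
        using lpn_powr[OF q0(1) y] y1 by simp
      moreover have "q * e / 4 * \<bar>t\<bar> * (\<Sum>n. norm (y n) powr q * norm (v n / y n)) \<le> q * e / 4 * \<bar>t\<bar> * 2"
        using suminf_norm_gradient_le[OF q y v'(1)] y1 vq q e by (intro mult_left_mono) auto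
      moreover have "C * \<bar>t\<bar> powr q * (\<Sum>n. norm (v n) powr q) \<le> q * e / 2 * \<bar>t\<bar> * 1"
      proof (rule mult_mono)
        have "C * \<bar>t\<bar> powr q = C * \<bar>t\<bar> powr (q - 1) * \<bar>t\<bar>"
          using powr_add[of "\<bar>t\<bar>" "q - 1" 1] by simp
        also have "\<dots> \<le> C * s powr (q - 1) * \<bar>t\<bar>"
          using C t q by (intro mult_right_mono mult_left_mono powr_mono2) auto
        finally show "C * \<bar>t\<bar> powr q \<le> q * e / 2 * \<bar>t\<bar>"
          by (simp add: sC)
        show "(\<Sum>n. norm (v n) powr q) \<le> 1"
          using vq v' q0 by (simp add: lpn_powr)
      qed (use q e S4 in \<open>auto intro: suminf_nonneg\<close>)
      ultimately show ?thesis
        unfolding eq2 by linarith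
    qed
    also have "\<dots> = 1 + q * (t * (lq_gradient q y v \<bullet> 1) + e * \<bar>t\<bar>)"
      by (simp add: algebra_simps)
    finally have "(lpn q (y + (\<lambda>n. of_real t * v n)) powr q) powr (1 / q)
        \<le> 1 + (t * (lq_gradient q y v \<bullet> 1) + e * \<bar>t\<bar>)"
      using q by (intro bernoulli_powr_le) auto
    then show ?thesis
      using q0 by (simp add: powr_powr)
  qed
  then show ?thesis
    using s by blast
qed

section \<open>Gateaux differentiability implies the two conditions\<close>

lemma smul_bops [simp]: "smul (bops (lp p) (lp q)) c A = (\<lambda>x n. c * A x n)"
  by (simp add: bops_def)

lemma unit_ball_bops_iff: "A \<in> unit_ball (bops (lp p) (lp q)) \<longleftrightarrow> A \<in> opc p q \<and> opn p q A \<le> 1"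
  by (simp add: unit_ball_def)

text \<open>
  The difference quotients in direction \<open>S\<close> are at least \<open>1\<close> for \<open>t > 0\<close> and at most \<open>0\<close> for \<open>t < 0\<close>.
\<close>

lemma not_gateaux_if_kink:
  fixes T S :: "(nat \<Rightarrow> 'a::{real_normed_field, real_inner}) \<Rightarrow> nat \<Rightarrow> 'a"
  assumes p: "0 < p" and q: "1 \<le> q" and S: "S \<in> opc p q"
    and one: "\<And>t. 1 \<le> opn p q (T + (\<lambda>x n. of_real t * S x n))"
    and abs: "\<And>t. \<bar>1 + t\<bar> \<le> opn p q (T + (\<lambda>x n. of_real t * S x n))"
  shows "\<not> gateaux_differentiable_norm (bops (lp p) (lp q)) T"
proof
  assume "gateaux_differentiable_norm (bops (lp p) (lp q)) T"
  then obtain f :: "((nat \<Rightarrow> 'a) \<Rightarrow> nat \<Rightarrow> 'a) \<Rightarrow> 'a" where f: "\<And>A. A \<in> opc p q \<Longrightarrow> opn p q A \<le> 1 \<Longrightarrow>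
      ((\<lambda>t. (opn p q (T + (\<lambda>x n. of_real t * A x n)) - 1) / t) \<longlongrightarrow> f A \<bullet> 1) (at (0::real))"
    unfolding gateaux_differentiable_norm_def smul_bops Ball_def unit_ball_bops_iff by blast
  \<comment> \<open>Gateaux differentiability speaks of directions in the unit ball, so
    \<open>S\<close> is scaled down.\<close>
  define c where "c = 1 / (opn p q S + 1)"
  have c: "0 < c" "c * opn p q S \<le> 1"
    using opn_nonneg[OF S] by (auto simp: c_def)
  define A where "A = (\<lambda>x n. of_real c * S x n)"
  have A: "A \<in> opc p q"
    using p q S by (simp add: A_def)
  have "opn p q A \<le> 1"
    using opn_scale[of p q S "of_real c"] p q S c unfolding A_def norm_of_real by simp
  then have lim: "((\<lambda>t. (opn p q (T + (\<lambda>x n. of_real t * A x n)) - 1) / t) \<longlongrightarrow> f A \<bullet> 1) (at (0::real))"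
    using f A by blast
  have eq: "(\<lambda>x n. of_real t * A x n) = (\<lambda>x n. of_real (t * c) * S x n)" for t
    by (simp add: A_def mult.assoc)
  have "c \<le> f A \<bullet> 1"
  proof (rule tendsto_lowerbound)
    show "((\<lambda>t. (opn p q (T + (\<lambda>x n. of_real t * A x n)) - 1) / t) \<longlongrightarrow> f A \<bullet> 1) (at_right (0::real))"
      using lim by (simp add: filterlim_at_split)
    show "\<forall>\<^sub>F t in at_right 0. c \<le> (opn p q (T + (\<lambda>x n. of_real t * A x n)) - 1) / t"
      using eventually_at_right_less
    proof eventually_elim
      case (elim t)
      then show ?case
        using abs[of "t * c"] c unfolding eq by (simp add: pos_le_divide_eq mult.commute)
    qed
  qed simp
  moreover have "f A \<bullet> 1 \<le> 0"
  proof (rule tendsto_upperbound)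
    show "((\<lambda>t. (opn p q (T + (\<lambda>x n. of_real t * A x n)) - 1) / t) \<longlongrightarrow> f A \<bullet> 1) (at_left (0::real))"
      using lim by (simp add: filterlim_at_split)
    have "\<forall>\<^sub>F t in at_left (0::real). t < 0"
      by (simp add: eventually_at_filter)
    then show "\<forall>\<^sub>F t in at_left 0. (opn p q (T + (\<lambda>x n. of_real t * A x n)) - 1) / t \<le> 0"
    proof eventually_elim
      case (elim t)
      then show ?case
        using one[of "t * c"] unfolding eq by (simp add: divide_nonneg_neg)
    qed
  qed simp
  ultimately show False
    using c by simp
qed

text \<open>
  If \<open>x1\<close> and \<open>x2\<close> are not proportional, some minor \<open>x1 i * x2 j - x1 j * x2 i\<close> is not zero. The
  corresponding functional \<open>h\<close> is \<open>1\<close> at \<open>x1\<close> and \<open>0\<close> at \<open>x2\<close>, and \<open>S x = h x T x1\<close> satisfies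
  \<open>\<parallel>(T + t S) x1\<parallel> = \<bar>1 + t\<bar>\<close> and \<open>\<parallel>(T + t S) x2\<parallel> = 1\<close>.
\<close>

lemma gateaux_imp_unique_maximizer:
  fixes T :: "(nat \<Rightarrow> 'a::{real_normed_field, real_inner}) \<Rightarrow> nat \<Rightarrow> 'a"
  assumes p: "1 \<le> p" and q: "1 \<le> q" and T: "T \<in> opc p q"
    and gat: "gateaux_differentiable_norm (bops (lp p) (lp q)) T"
    and x1: "x1 \<in> unit_ball (lp p)" and x2: "x2 \<in> unit_ball (lp p)"
    and max: "lpn q (T x1) = 1" "lpn q (T x2) = 1"
  shows "\<exists>\<alpha>. norm \<alpha> = 1 \<and> x1 = (\<lambda>n. \<alpha> * x2 n)"
proof -
  have p0: "0 < p" and q0: "0 < q"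
    using p q by auto
  have T1: "opn p q T = 1"
    using gat by (simp add: gateaux_differentiable_norm_def unit_sphere_def)
  have in': "x1 \<in> lpc p" "x2 \<in> lpc p"
    using x1 x2 by (auto simp: unit_ball_lp_iff)
  have n1: "lpn p x = 1" if "x \<in> unit_ball (lp p)" "lpn q (T x) = 1" for x
    using that opn_bound[OF p0 q0 T, of x] T1 by (auto simp: unit_ball_lp_iff)
  have proportional: "x1 i * x2 j = x1 j * x2 i" for i j
  proof (rule ccontr)
    assume neq: "x1 i * x2 j \<noteq> x1 j * x2 i"
    define h where "h x = (x i * x2 j - x j * x2 i) / (x1 i * x2 j - x1 j * x2 i)" for x
    have h: "h x1 = 1" "h x2 = 0"
      using neq by (auto simp: h_def mult.commute)
    define S where "S x = (if x \<in> lpc p then (\<lambda>n. h x * T x1 n) else 0)" for x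
    define C where "C = (norm (x2 j) + norm (x2 i)) / norm (x1 i * x2 j - x1 j * x2 i)"
    have hC: "norm (h x) \<le> C * lpn p x" if x: "x \<in> lpc p" for x
    proof -
      have "norm (x i * x2 j - x j * x2 i) \<le> norm (x i * x2 j) + norm (x j * x2 i)"
        by (rule norm_triangle_ineq4)
      also have "\<dots> \<le> lpn p x * norm (x2 j) + lpn p x * norm (x2 i)"
        unfolding norm_mult using norm_component_le_lpn[OF p0 x]
        by (intro add_mono mult_right_mono) auto
      finally have "norm (x i * x2 j - x j * x2 i) \<le> (norm (x2 j) + norm (x2 i)) * lpn p x"
        by (simp add: algebra_simps)
      then show ?thesis
        by (simp add: h_def C_def norm_divide divide_right_mono)
    qed
    have S: "S \<in> opc p q"
    proof (rule opcI[where C = C])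
      fix x y :: "nat \<Rightarrow> 'a" and c
      assume x: "x \<in> lpc p"
      show "S x \<in> lpc q"
        using x op_lpc[OF T in'(1)] by (simp add: S_def)
      show "S (\<lambda>n. c * x n) = (\<lambda>n. c * S x n)"
        using x lpc_scale[OF x, of c] by (simp add: S_def h_def fun_eq_iff right_diff_distrib)
      show "lpn q (S x) \<le> C * lpn p x"
        using x hC[OF x] lpn_scale[OF q0 op_lpc[OF T in'(1)], of "h x"] max by (simp add: S_def)
      assume y: "y \<in> lpc p"
      show "S (x + y) = S x + S y"
        using x y p by (simp add: S_def h_def fun_eq_iff add_divide_distrib diff_divide_distrib algebra_simps)
    qed (simp add: S_def)
    have B: "T + (\<lambda>x n. of_real t * S x n) \<in> opc p q" for t
      using p0 q q0 T S by simp
    have "\<not> gateaux_differentiable_norm (bops (lp p) (lp q)) T"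
    proof (rule not_gateaux_if_kink[OF p0 q S])
      fix t :: real
      have "(T + (\<lambda>x n. of_real t * S x n)) x2 = T x2"
        using in' h by (simp add: S_def fun_eq_iff)
      then show "1 \<le> opn p q (T + (\<lambda>x n. of_real t * S x n))"
        using opn_ball[OF B x2] max by metis
      have "(T + (\<lambda>x n. of_real t * S x n)) x1 = (\<lambda>n. of_real (1 + t) * T x1 n)"
        using in' h by (simp add: S_def fun_eq_iff distrib_right)
      then have "lpn q ((T + (\<lambda>x n. of_real t * S x n)) x1) = \<bar>1 + t\<bar>"
        using lpn_scale[OF q0 op_lpc[OF T in'(1)], of "of_real (1 + t)"] max
        unfolding norm_of_real by simp
      then show "\<bar>1 + t\<bar> \<le> opn p q (T + (\<lambda>x n. of_real t * S x n))"
        using opn_ball[OF B x1] by metis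
    qed
    then show False
      using gat by blast
  qed
  have "x2 \<noteq> 0"
    using n1[OF x2 max(2)] by auto
  then obtain j where j: "x2 j \<noteq> 0"
    by (auto simp: fun_eq_iff)
  define \<alpha> where "\<alpha> = x1 j / x2 j"
  have eq: "x1 = (\<lambda>n. \<alpha> * x2 n)"
    using proportional[of _ j] j by (simp add: \<alpha>_def fun_eq_iff field_simps)
  have "norm \<alpha> = 1"
    using lpn_scale[OF p0 in'(2), of \<alpha>] n1[OF x1 max(1)] n1[OF x2 max(2)] unfolding eq[symmetric] by simp
  then show ?thesis
    using eq by blast
qed

lemma one_le_if_inverse_Suc:
  fixes s :: real
  assumes "\<And>j. 1 - inverse (real (Suc j)) \<le> s"
  shows "1 \<le> s"
proof (rule ccontr)
  assume "\<not> 1 \<le> s"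
  then obtain j where "inverse (real (Suc j)) < 1 - s"
    using reals_Archimedean[of "1 - s"] by auto
  then show False
    using assms[of j] by linarith
qed

lemma opn_restr_le:
  assumes "0 < p" "0 < q" "A \<in> opc p q"
  shows "opn p q (\<lambda>x. restr E (A x)) \<le> opn p q A"
proof (rule opn_le)
  fix x :: "nat \<Rightarrow> 'a"
  assume x: "x \<in> unit_ball (lp p)"
  then have "lpn q (restr E (A x)) \<le> lpn q (A x)"
    using assms op_lpc[OF assms(3)] by (intro lpn_restr_le) (auto simp: unit_ball_lp_iff)
  then show "lpn q (restr E (A x)) \<le> opn p q A"
    using opn_ball[OF assms(3) x] by linarith
qed

text \<open>
  Gliding hump. All tails of \<open>T\<close> have norm at least \<open>1\<close>, so there are consecutive blocks \<open>B k\<close> of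
  coordinates and vectors of the unit ball whose images have norm almost \<open>1\<close> on \<open>B k\<close>. The union \<open>E\<close> of the even
  blocks and its complement, which contains the odd ones, then both carry the full norm.
\<close>

lemma splitting_if_ess_norm_ge_1:
  fixes T :: "(nat \<Rightarrow> 'a::{real_normed_field, heine_borel}) \<Rightarrow> nat \<Rightarrow> 'a"
  assumes p: "0 < p" and q: "1 \<le> q" and T: "T \<in> opc p q"
    and ess: "\<not> ess_norm (lp p) (lp q) T < 1"
  shows "\<exists>E. 1 \<le> opn p q (\<lambda>x. restr E (T x)) \<and> 1 \<le> opn p q (\<lambda>x. restr (- E) (T x))"
proof -
  have q0: "0 < q"
    using q by simp
  have "\<exists>N>n. \<exists>x\<in>unit_ball (lp p). 1 - inverse (real (Suc k)) < lpn q (restr {n..<N} (T x))" for n k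
  proof -
    have "1 \<le> opn p q (\<lambda>x. restr {n..} (T x))"
      using ess ess_norm_less_iff[OF p q T, of 1] by (meson not_le)
    moreover have "0 < inverse (real (Suc k))"
      by simp
    ultimately have "1 - inverse (real (Suc k)) < opn p q (\<lambda>x. restr {n..} (T x))"
      by linarith
    then obtain x where x: "x \<in> unit_ball (lp p)"
      and less: "1 - inverse (real (Suc k)) < lpn q (restr {n..} (T x))"
      using opn_less_witness[OF op_restr[OF p q0 T]] by blast
    define y where "y = restr {n..} (T x)"
    have y: "y \<in> lpc q"
      using x op_lpc[OF T] q0 by (auto simp: y_def unit_ball_lp_iff)
    have "\<forall>\<^sub>F N in sequentially. lpn q (restr {N..} y) < lpn q y - (1 - inverse (real (Suc k)))"
      using less by (intro order_tendstoD(2)[OF lpn_restr_tail_tendsto_0[OF q0 y]]) (simp add: y_def)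
    then have "\<forall>\<^sub>F N in sequentially. lpn q (restr {N..} y) < lpn q y - (1 - inverse (real (Suc k))) \<and> n < N"
      using eventually_gt_at_top[of n] by (rule eventually_conj)
    then obtain N where N: "lpn q (restr {N..} y) < lpn q y - (1 - inverse (real (Suc k)))" "n < N"
      by (auto simp: eventually_sequentially)
    have "restr {..<N} y = restr {n..<N} (T x)" "y = restr {..<N} y + restr {N..} y"
      by (auto simp: y_def restr_def fun_eq_iff)
    then have "lpn q y \<le> lpn q (restr {n..<N} (T x)) + lpn q (restr {N..} y)"
      using lpn_triangle[OF q restr_lpc[OF q0 y] restr_lpc[OF q0 y], of "{..<N}" "{N..}"] by simp
    then show ?thesis
      using N x by (intro exI[of _ N] conjI bexI[of _ x]) auto
  qed
  \<comment> \<open>\<open>M n k\<close> is the end of a block that begins at \<open>n\<close>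
    and carries norm more than \<open>1 - 1 / (k + 1)\<close>.\<close>
  then obtain M where M: "\<And>n k. n < M n k"
    "\<And>n k. \<exists>x\<in>unit_ball (lp p). 1 - inverse (real (Suc k)) < lpn q (restr {n..<M n k} (T x))"
    by metis
  define a where "a = rec_nat 0 (\<lambda>k n. M n k)"
  have a: "a (Suc k) = M (a k) k" for k
    by (simp add: a_def)
  have mono: "strict_mono a"
    by (simp add: strict_mono_Suc_iff a M)
  define B where "B k = {a k..<a (Suc k)}" for k
  define E where "E = (\<Union>k\<in>{k. even k}. B k)"
  have same: "k = l" if "i \<in> B k" "i \<in> B l" for i k l
  proof (rule ccontr)
    assume "k \<noteq> l"
    then have "a (Suc k) \<le> a l \<or> a (Suc l) \<le> a k"
      using mono by (auto simp: strict_mono_less_eq)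
    then show False
      using that by (auto simp: B_def)
  qed
  have large: "1 - inverse (real (Suc k)) \<le> opn p q (\<lambda>x. restr F (T x))" if sub: "B k \<subseteq> F" for k F
  proof -
    obtain x where x: "x \<in> unit_ball (lp p)" "1 - inverse (real (Suc k)) < lpn q (restr (B k) (T x))"
      using M(2)[of k "a k"] by (auto simp: B_def a)
    have "restr (B k) (T x) = restr (B k) (restr F (T x))"
      using sub by (simp add: restr_restr inf.absorb1)
    then have "lpn q (restr (B k) (T x)) \<le> lpn q (restr F (T x))"
      using x op_lpc[OF T] q0 by (auto simp: unit_ball_lp_iff intro!: lpn_restr_le)
    also have "\<dots> \<le> opn p q (\<lambda>x. restr F (T x))"
      using opn_ball[OF op_restr[OF p q0 T] x(1)] .
    finally show ?thesis
      using x by simp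
  qed
  have inv: "1 - inverse (real (Suc j)) \<le> 1 - inverse (real (Suc k))" if "j \<le> k" for j k
    using that by (simp add: le_imp_inverse_le)
  have "1 \<le> opn p q (\<lambda>x. restr E (T x))"
  proof (rule one_le_if_inverse_Suc)
    fix j
    have "B (2 * j) \<subseteq> E"
      unfolding E_def by (rule UN_upper) simp
    then show "1 - inverse (real (Suc j)) \<le> opn p q (\<lambda>x. restr E (T x))"
      using large[of "2 * j" E] inv[of j "2 * j"] by linarith
  qed
  moreover have "1 \<le> opn p q (\<lambda>x. restr (- E) (T x))"
  proof (rule one_le_if_inverse_Suc)
    fix j
    have "B (2 * j + 1) \<subseteq> - E"
    proof
      fix i
      assume i: "i \<in> B (2 * j + 1)"
      have "odd k" if "i \<in> B k" for k
        using same[OF that i] by simp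
      then show "i \<in> - E"
        unfolding E_def by blast
    qed
    then show "1 - inverse (real (Suc j)) \<le> opn p q (\<lambda>x. restr (- E) (T x))"
      using large[of "2 * j + 1" "- E"] inv[of j "2 * j + 1"] by linarith
  qed
  ultimately show ?thesis
    by blast
qed

text \<open>
  With \<open>E\<close> as in \<open>splitting_if_ess_norm_ge_1\<close> take \<open>S = restr E \<circ> T\<close>: on \<open>E\<close> the operator \<open>T + t S\<close> is
  \<open>(1 + t) T\<close>, and on the complement it is \<open>T\<close>.
\<close>

lemma gateaux_imp_ess_norm_less_1:
  fixes T :: "(nat \<Rightarrow> 'a::{real_normed_field, euclidean_space}) \<Rightarrow> nat \<Rightarrow> 'a"
  assumes p: "0 < p" and q: "1 \<le> q" and T: "T \<in> opc p q"
    and gat: "gateaux_differentiable_norm (bops (lp p) (lp q)) T"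
  shows "ess_norm (lp p) (lp q) T < 1"
proof (rule ccontr)
  assume "\<not> ?thesis"
  then obtain E where E: "1 \<le> opn p q (\<lambda>x. restr E (T x))" "1 \<le> opn p q (\<lambda>x. restr (- E) (T x))"
    using splitting_if_ess_norm_ge_1[OF p q T] by blast
  have q0: "0 < q"
    using q by simp
  define S where "S = (\<lambda>x. restr E (T x))"
  have S: "S \<in> opc p q"
    using p q0 T by (simp add: S_def)
  have "\<not> gateaux_differentiable_norm (bops (lp p) (lp q)) T"
  proof (rule not_gateaux_if_kink[OF p q S])
    fix t :: real
    define A where "A = T + (\<lambda>x n. of_real t * S x n)"
    have A: "A \<in> opc p q"
      using p q q0 T S by (simp add: A_def)
    have "(\<lambda>x. restr (- E) (A x)) = (\<lambda>x. restr (- E) (T x))"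
      by (auto simp: A_def S_def restr_def fun_eq_iff)
    then have "1 \<le> opn p q A"
      using opn_restr_le[OF p q0 A, of "- E"] E(2) by simp
    then show "1 \<le> opn p q (T + (\<lambda>x n. of_real t * S x n))"
      by (simp only: A_def)
    have "\<bar>1 + t\<bar> \<le> opn p q A"
    proof (cases "1 + t = 0")
      case True
      then show ?thesis
        using opn_nonneg[OF A] by simp
    next
      case False
      then have pos: "0 < \<bar>1 + t\<bar>"
        by simp
      have "opn p q (\<lambda>x. restr E (T x)) \<le> opn p q A / \<bar>1 + t\<bar>"
      proof (rule opn_le)
        fix x :: "nat \<Rightarrow> 'a"
        assume x: "x \<in> unit_ball (lp p)"
        have "restr E (A x) = (\<lambda>n. of_real (1 + t) * restr E (T x) n)"
          by (auto simp: A_def S_def restr_def fun_eq_iff distrib_right)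
        moreover have "restr E (T x) \<in> lpc q"
          using x op_lpc[OF T] q0 by (auto simp: unit_ball_lp_iff)
        ultimately have "lpn q (restr E (A x)) = \<bar>1 + t\<bar> * lpn q (restr E (T x))"
          using lpn_scale[OF q0, of "restr E (T x)" "of_real (1 + t)"] unfolding norm_of_real by simp
        moreover have "lpn q (restr E (A x)) \<le> opn p q A"
          using opn_ball[OF op_restr[OF p q0 A] x] opn_restr_le[OF p q0 A] by (rule order_trans)
        ultimately show "lpn q (restr E (T x)) \<le> opn p q A / \<bar>1 + t\<bar>"
          using pos by (simp add: pos_le_divide_eq mult.commute)
      qed
      then have "1 \<le> opn p q A / \<bar>1 + t\<bar>"
        using E(1) by linarith
      then show ?thesis
        using pos by (simp add: pos_le_divide_eq)
    qed
    then show "\<bar>1 + t\<bar> \<le> opn p q (T + (\<lambda>x n. of_real t * S x n))"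
      by (simp add: A_def)
  qed
  then show False
    using gat by blast
qed

section \<open>The two conditions imply Frechet differentiability\<close>

lemma lpn_op_tendsto:
  fixes T :: "(nat \<Rightarrow> 'a::real_normed_field) \<Rightarrow> nat \<Rightarrow> 'a"
  assumes p: "1 \<le> p" and q: "1 \<le> q" and T: "T \<in> opc p q"
    and x: "\<And>n. x n \<in> lpc p" and z: "z \<in> lpc p" and lim: "(\<lambda>n. lpn p (x n - z)) \<longlonglongrightarrow> 0"
  shows "(\<lambda>n. lpn q (T (x n))) \<longlonglongrightarrow> lpn q (T z)"
proof (rule LIM_zero_cancel, rule Lim_null_comparison)
  have pq: "0 < p" "0 < q"
    using p q by auto
  have "\<bar>lpn q (T (x n)) - lpn q (T z)\<bar> \<le> opn p q T * lpn p (x n - z)" for n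
    using lpn_diff_le[OF q op_lpc[OF T x] op_lpc[OF T z], of n] opn_bound[OF pq T, of "x n - z"]
      op_diff[OF T x z, of n] x z p by simp
  then show "\<forall>\<^sub>F n in sequentially. norm (lpn q (T (x n)) - lpn q (T z)) \<le> opn p q T * lpn p (x n - z)"
    by simp
  show "(\<lambda>n. opn p q T * lpn p (x n - z)) \<longlonglongrightarrow> 0"
    using tendsto_mult[OF tendsto_const lim] by simp
qed

context
  fixes p q :: real and T :: "(nat \<Rightarrow> 'a::{real_normed_field, euclidean_space}) \<Rightarrow> nat \<Rightarrow> 'a"
  assumes p: "1 < p" and q: "1 < q" and T: "T \<in> opc p q" and T1: "opn p q T = 1"
    and ess: "ess_norm (lp p) (lp q) T < 1"
begin

lemma almost_maximizers_converge:
  assumes x: "\<And>n. x n \<in> unit_ball (lp p)" and large: "\<And>n. 1 - inverse (real (Suc n)) < lpn q (T (x n))"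
  shows "\<exists>z r. z \<in> unit_ball (lp p) \<and> lpn q (T z) = 1 \<and> strict_mono (r::nat \<Rightarrow> nat) \<and>
    (\<lambda>n. lpn p (x (r n) - z)) \<longlonglongrightarrow> 0"
proof -
  have lim: "(\<lambda>n. lpn q (T (x n))) \<longlonglongrightarrow> 1"
  proof (rule tendsto_sandwich)
    show "\<forall>\<^sub>F n in sequentially. 1 - inverse (real (Suc n)) \<le> lpn q (T (x n))"
      using large by (intro always_eventually allI less_imp_le)
    show "\<forall>\<^sub>F n in sequentially. lpn q (T (x n)) \<le> 1"
      using opn_ball[OF T x] T1 by simp
    show "(\<lambda>n. 1 - inverse (real (Suc n))) \<longlonglongrightarrow> 1"
      using tendsto_diff[OF tendsto_const LIMSEQ_inverse_real_of_nat, of 1] by simp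
  qed simp
  obtain z r where z: "z \<in> unit_ball (lp p)" and r: "strict_mono r"
    and conv: "(\<lambda>n. lpn p (x (r n) - z)) \<longlonglongrightarrow> 0"
    using maximizing_sequence_converges[OF p q T T1 ess x lim] by blast
  have "(\<lambda>n. lpn q (T (x (r n)))) \<longlonglongrightarrow> lpn q (T z)"
    using p q T x z conv by (intro lpn_op_tendsto) (auto simp: unit_ball_lp_iff)
  moreover have "(\<lambda>n. lpn q (T (x (r n)))) \<longlonglongrightarrow> 1"
    using LIMSEQ_subseq_LIMSEQ[OF lim r] by (simp add: comp_def)
  ultimately have "lpn q (T z) = 1"
    using LIMSEQ_unique by blast
  then show ?thesis
    using z r conv by blast
qed

lemma norm_attained: "\<exists>z\<in>unit_ball (lp p). lpn q (T z) = 1"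
proof -
  have "\<exists>x\<in>unit_ball (lp p). 1 - inverse (real (Suc n)) < lpn q (T x)" for n
    by (rule opn_less_witness[OF T]) (simp add: T1)
  then show ?thesis
    using almost_maximizers_converge by metis
qed

text \<open>
  Otherwise there would be a maximizing sequence far from all unimodular multiples of \<open>z\<close>. A
  subsequence converges to a vector at which the norm is attained, and by uniqueness this vector is
  such a multiple.
\<close>

lemma almost_maximizers_near_maximizer:
  assumes unique: "\<And>x1 x2. x1 \<in> unit_ball (lp p) \<Longrightarrow> x2 \<in> unit_ball (lp p) \<Longrightarrow>
      lpn q (T x1) = 1 \<Longrightarrow> lpn q (T x2) = 1 \<Longrightarrow> \<exists>\<alpha>. norm \<alpha> = 1 \<and> x1 = (\<lambda>n. \<alpha> * x2 n)"
    and z: "z \<in> unit_ball (lp p)" "lpn q (T z) = 1" and \<eta>: "0 < \<eta>"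
  shows "\<exists>\<delta>>0. \<forall>x\<in>unit_ball (lp p). 1 - \<delta> < lpn q (T x) \<longrightarrow>
    (\<exists>\<alpha>. norm \<alpha> = 1 \<and> lpn p ((\<lambda>n. \<alpha> * x n) - z) \<le> \<eta>)"
proof (rule ccontr)
  assume neg: "\<not> ?thesis"
  have "\<exists>x\<in>unit_ball (lp p). 1 - inverse (real (Suc n)) < lpn q (T x) \<and>
      (\<forall>\<alpha>. norm \<alpha> = 1 \<longrightarrow> \<eta> < lpn p ((\<lambda>n. \<alpha> * x n) - z))" for n
  proof -
    have "0 < inverse (real (Suc n))"
      by simp
    then show ?thesis
      using neg by (meson not_le)
  qed
  then obtain x where x: "\<And>n. x n \<in> unit_ball (lp p)"
    "\<And>n. 1 - inverse (real (Suc n)) < lpn q (T (x n))"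
    and far: "\<And>n \<alpha>. norm \<alpha> = 1 \<Longrightarrow> \<eta> < lpn p ((\<lambda>i. \<alpha> * x n i) - z)"
    by metis
  obtain w r where w: "w \<in> unit_ball (lp p)" "lpn q (T w) = 1"
    and conv: "(\<lambda>n. lpn p (x (r n) - w)) \<longlonglongrightarrow> 0"
    using almost_maximizers_converge[of x] x by blast
  obtain \<alpha> where \<alpha>: "norm \<alpha> = 1" "z = (\<lambda>n. \<alpha> * w n)"
    using unique[OF z(1) w(1) z(2) w(2)] by blast
  have "\<eta> < lpn p (x (r n) - w)" for n
  proof -
    have "x (r n) - w \<in> lpc p"
      using x(1)[of "r n"] w(1) p by (auto simp: unit_ball_lp_iff)
    moreover have "(\<lambda>i. \<alpha> * x (r n) i) - z = (\<lambda>i. \<alpha> * (x (r n) - w) i)"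
      by (auto simp: \<alpha>(2) fun_eq_iff right_diff_distrib)
    ultimately have "lpn p ((\<lambda>i. \<alpha> * x (r n) i) - z) = lpn p (x (r n) - w)"
      using lpn_scale[of p "x (r n) - w" \<alpha>] p \<alpha>(1) by simp
    then show ?thesis
      using far[OF \<alpha>(1), of "r n"] by simp
  qed
  then have "\<eta> \<le> 0"
    by (intro LIMSEQ_le_const[OF conv]) (meson less_imp_le)
  then show False
    using \<eta> by simp
qed

text \<open>
  Below, \<open>B = T + t A\<close> and \<open>G\<close> is the derivative of \<open>\<parallel>T z + t A z\<parallel>\<close> at \<open>t = 0\<close>. The lower estimate follows
  by testing \<open>B\<close> at \<open>z\<close>. For the upper one, vectors \<open>x\<close> with \<open>\<parallel>T x\<parallel> \<le> 1 - \<delta>\<close> do not matter when \<open>\<bar>t\<bar>\<close> is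
  small. All other \<open>x\<close> may be rotated to be close to \<open>z\<close>. Then convexity of \<open>r \<mapsto> \<parallel>T x + r A x\<parallel>\<close> compares
  its value at \<open>t\<close> with the one at \<open>s\<close> or \<open>- s\<close>, where \<open>s\<close> depends on \<open>e\<close> but not on \<open>A\<close> or \<open>t\<close>. At this fixed
  distance, replacing \<open>x\<close> by \<open>z\<close> costs at most a multiple of \<open>e * s\<close>, provided that \<open>x\<close> is within
  \<open>e * s\<close> of \<open>z\<close>.
\<close>

lemma norm_expansion:
  assumes unique: "\<And>x1 x2. x1 \<in> unit_ball (lp p) \<Longrightarrow> x2 \<in> unit_ball (lp p) \<Longrightarrow>
      lpn q (T x1) = 1 \<Longrightarrow> lpn q (T x2) = 1 \<Longrightarrow> \<exists>\<alpha>. norm \<alpha> = 1 \<and> x1 = (\<lambda>n. \<alpha> * x2 n)"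
    and z: "z \<in> unit_ball (lp p)" "lpn q (T z) = 1" and e: "0 < e"
  shows "\<exists>d>0. \<forall>A t. A \<in> opc p q \<longrightarrow> opn p q A \<le> 1 \<longrightarrow> \<bar>t\<bar> < d \<longrightarrow>
    \<bar>opn p q (T + (\<lambda>x n. of_real t * A x n)) - 1 - t * (lq_gradient q (T z) (A z) \<bullet> 1)\<bar> \<le> 3 * e * \<bar>t\<bar>"
proof -
  have p0: "0 < p" "1 \<le> p" and q0: "0 < q" "1 \<le> q"
    using p q by auto
  have z': "z \<in> lpc p"
    using z by (simp add: unit_ball_lp_iff)
  have Tz: "T z \<in> lpc q"
    by (rule op_lpc[OF T z'])
  obtain s0 where s0: "0 < s0" and smooth0: "\<And>v t. v \<in> unit_ball (lp q) \<Longrightarrow> \<bar>t\<bar> \<le> s0 \<Longrightarrow>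
      lpn q (T z + (\<lambda>n. of_real t * v n)) \<le> 1 + t * (lq_gradient q (T z) v \<bullet> 1) + e * \<bar>t\<bar>"
    using lq_norm_smooth_upper[OF q Tz z(2) e] by blast
  define s where "s = min s0 1"
  have s: "0 < s" "s \<le> 1" and smooth: "\<And>v t. v \<in> unit_ball (lp q) \<Longrightarrow> \<bar>t\<bar> \<le> s \<Longrightarrow>
      lpn q (T z + (\<lambda>n. of_real t * v n)) \<le> 1 + t * (lq_gradient q (T z) v \<bullet> 1) + e * \<bar>t\<bar>"
    using s0 smooth0 by (auto simp: s_def)
  have \<eta>: "0 < e * s"
    using e s by simp
  obtain \<delta> where \<delta>: "0 < \<delta>" and near: "\<And>x. x \<in> unit_ball (lp p) \<Longrightarrow> 1 - \<delta> < lpn q (T x) \<Longrightarrow>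
      \<exists>\<alpha>. norm \<alpha> = 1 \<and> lpn p ((\<lambda>n. \<alpha> * x n) - z) \<le> e * s"
    using almost_maximizers_near_maximizer[OF unique z \<eta>] by blast
  \<comment> \<open>The bound \<open>\<delta> / 3\<close> gives \<open>1 - \<delta> +
    \<bar>t\<bar> \<le> 1 - 2 * \<bar>t\<bar>\<close>, and \<open>\<bar>G\<bar>\<close> below is
    at most \<open>2\<close>.\<close>
  define d where "d = min s (\<delta> / 3)"
  have "\<bar>opn p q (T + (\<lambda>x n. of_real t * A x n)) - 1 - t * (lq_gradient q (T z) (A z) \<bullet> 1)\<bar> \<le> 3 * e * \<bar>t\<bar>"
    if A: "A \<in> opc p q" "opn p q A \<le> 1" and t: "\<bar>t\<bar> < d" for A t
  proof -
    define v where "v = A z"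
    define G where "G = lq_gradient q (T z) v \<bullet> 1"
    define B where "B = T + (\<lambda>x n. of_real t * A x n)"
    have B: "B \<in> opc p q"
      using T A p0 q0 by (simp add: B_def)
    have ts: "\<bar>t\<bar> \<le> s" "3 * \<bar>t\<bar> \<le> \<delta>"
      using t by (auto simp: d_def)
    have contr: "lpn q (A x) \<le> 1" if "x \<in> unit_ball (lp p)" for x
      using opn_ball[OF A(1) that] A(2) by linarith
    have v: "v \<in> unit_ball (lp q)" "v \<in> lpc q" "lpn q v \<le> 1"
      using op_lpc[OF A(1) z'] contr[OF z(1)] by (auto simp: v_def unit_ball_lp_iff)
    have "norm (lq_gradient q (T z) v) \<le> 2"
      using norm_lq_gradient_le[OF q Tz v(2) z(2)] v(3) by linarith
    then have G2: "\<bar>G\<bar> \<le> 2"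
      using abs_inner_one_le[of "lq_gradient q (T z) v"] by (simp add: G_def)
    have Bz: "B z = T z + (\<lambda>n. of_real t * v n)"
      by (simp add: B_def v_def plus_fun_def)
    have in_t: "(\<lambda>n. of_real c * v n) \<in> lpc q" for c
      using v by simp
    have lower: "1 + t * G - e * \<bar>t\<bar> \<le> opn p q B"
    proof -
      have "T z + T z = (T z + (\<lambda>n. of_real t * v n)) + (T z + (\<lambda>n. of_real (- t) * v n))"
        by (auto simp: fun_eq_iff)
      moreover have "lpn q (T z + T z) = 2"
      proof -
        have "T z + T z = (\<lambda>n. of_real 2 * T z n)"
          by (auto simp: fun_eq_iff)
        then have "lpn q (T z + T z) = norm (of_real 2 :: 'a) * lpn q (T z)"
          using lpn_scale[OF q0(1) Tz, of "of_real 2"] by simp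
        then show ?thesis
          unfolding norm_of_real using z by simp
      qed
      ultimately have "2 \<le> lpn q (B z) + lpn q (T z + (\<lambda>n. of_real (- t) * v n))"
        using lpn_triangle[OF q0(2), of "T z + (\<lambda>n. of_real t * v n)" "T z + (\<lambda>n. of_real (- t) * v n)"]
          Tz in_t q0 by (simp only: Bz lpc_add)
      moreover have "lpn q (T z + (\<lambda>n. of_real (- t) * v n)) \<le> 1 + - t * G + e * \<bar>- t\<bar>"
        unfolding G_def using ts by (intro smooth v(1)) simp
      ultimately show ?thesis
        using opn_ball[OF B z(1)] by simp
    qed
    have "opn p q B \<le> 1 + t * G + 3 * e * \<bar>t\<bar>"
    proof (rule opn_le)
      fix x :: "nat \<Rightarrow> 'a"
      assume x: "x \<in> unit_ball (lp p)"
      show "lpn q (B x) \<le> 1 + t * G + 3 * e * \<bar>t\<bar>"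
      proof (cases "1 - \<delta> < lpn q (T x)")
        case False
        have x': "x \<in> lpc p"
          using x by (simp add: unit_ball_lp_iff)
        have Ax: "(\<lambda>n. of_real t * A x n) \<in> lpc q"
          using op_lpc[OF A(1) x'] by simp
        have "lpn q (B x) \<le> lpn q (T x) + lpn q (\<lambda>n. of_real t * A x n)"
          using lpn_triangle[OF q0(2) op_lpc[OF T x'] Ax] by (simp add: B_def)
        also have "lpn q (\<lambda>n. of_real t * A x n) \<le> \<bar>t\<bar> * 1"
          unfolding lpn_scale[OF q0(1) op_lpc[OF A(1) x']] norm_of_real
          using contr[OF x] by (intro mult_left_mono) auto
        also have "lpn q (T x) + \<bar>t\<bar> * 1 \<le> 1 - 2 * \<bar>t\<bar>"
          using False ts by linarith
        also have "\<dots> \<le> 1 + t * G"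
        proof -
          have "\<bar>t * G\<bar> \<le> \<bar>t\<bar> * 2"
            unfolding abs_mult using G2 by (intro mult_left_mono) auto
          then show ?thesis
            by linarith
        qed
        finally show ?thesis
          using e by (simp add: add_increasing2)
      next
        case True
        then obtain \<alpha> where \<alpha>: "norm \<alpha> = 1" and close: "lpn p ((\<lambda>n. \<alpha> * x n) - z) \<le> e * s"
          using near[OF x] by blast
        define x' where "x' = (\<lambda>n. \<alpha> * x n)"
        have x'b: "x' \<in> unit_ball (lp p)" and x': "x' \<in> lpc p"
          using phase_ball[OF p0(1) \<alpha> x] by (auto simp: x'_def unit_ball_lp_iff)
        define u w where "u = T x'" and "w = A x'"
        have uw: "u \<in> lpc q" "w \<in> lpc q"
          using op_lpc[OF T x'] op_lpc[OF A(1) x'] by (auto simp: u_def w_def)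
        have u1: "lpn q u \<le> 1"
          using opn_ball[OF T x'b] T1 by (simp add: u_def)
        have diff: "x' - z \<in> lpc p"
          using x' z' p0 by simp
        have uT: "u - T z \<in> lpc q" "lpn q (u - T z) \<le> e * s"
          using op_lpc[OF T diff] opn_bound[OF p0(1) q0(1) T diff] close T1
          by (auto simp: u_def x'_def[symmetric] op_diff[OF T x' z'])
        have "opn p q A * lpn p (x' - z) \<le> 1 * lpn p (x' - z)"
          using A by (intro mult_right_mono) auto
        then have wv: "w - v \<in> lpc q" "lpn q (w - v) \<le> e * s"
          using op_lpc[OF A(1) diff] opn_bound[OF p0(1) q0(1) A(1) diff] close
          by (auto simp: w_def v_def x'_def[symmetric] op_diff[OF A(1) x' z'])
        \<comment> \<open>\<open>B x'\<close> is the convex combination of \<open>u = T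
          x'\<close> and \<open>g = T x' + \<sigma> A x'\<close> with weight \<open>l\<close> on
          \<open>g\<close>.\<close>
        define \<sigma> where "\<sigma> = (if 0 \<le> t then s else - s)"
        define l where "l = \<bar>t\<bar> / s"
        have l: "0 \<le> l" "l \<le> 1" "t = l * \<sigma>" "l * s = \<bar>t\<bar>" and \<sigma>: "\<bar>\<sigma>\<bar> = s"
          using s ts by (auto simp: l_def \<sigma>_def divide_le_eq_1)
        define g where "g = u + (\<lambda>n. of_real \<sigma> * w n)"
        have g: "g \<in> lpc q"
          using uw q0 by (simp add: g_def)
        have gle: "lpn q g \<le> 1 + \<sigma> * G + 3 * e * s"
        proof -
          have "g = (T z + (\<lambda>n. of_real \<sigma> * v n)) + ((u - T z) + (\<lambda>n. of_real \<sigma> * (w - v) n))"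
            by (auto simp: g_def fun_eq_iff algebra_simps)
          moreover have swv: "(\<lambda>n. of_real \<sigma> * (w - v) n) \<in> lpc q"
            using lpc_scale[OF wv(1)] .
          ultimately have "lpn q g \<le> lpn q (T z + (\<lambda>n. of_real \<sigma> * v n))
              + (lpn q (u - T z) + lpn q (\<lambda>n. of_real \<sigma> * (w - v) n))"
            using lpn_triangle[OF q0(2) lpc_add[OF q0(2) Tz in_t[of \<sigma>]] lpc_add[OF q0(2) uT(1) swv]]
              lpn_triangle[OF q0(2) uT(1) swv]
            by (simp only:)
          moreover have "lpn q (\<lambda>n. of_real \<sigma> * (w - v) n) \<le> e * s"
          proof -
            have "lpn q (\<lambda>n. of_real \<sigma> * (w - v) n) = s * lpn q (w - v)"
              unfolding lpn_scale[OF q0(1) wv(1)] norm_of_real \<sigma> ..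
            also have "\<dots> \<le> 1 * lpn q (w - v)"
              using s by (intro mult_right_mono) auto
            finally show ?thesis
              using wv(2) by linarith
          qed
          moreover have "lpn q (T z + (\<lambda>n. of_real \<sigma> * v n)) \<le> 1 + \<sigma> * G + e * s"
            using smooth[OF v(1), of \<sigma>] \<sigma> by (simp add: G_def)
          ultimately show ?thesis
            using uT(2) by linarith
        qed
        have "B x' = (\<lambda>n. of_real (1 - l) * u n) + (\<lambda>n. of_real l * g n)"
          by (auto simp: B_def u_def w_def g_def fun_eq_iff l(3) algebra_simps)
        then have "lpn q (B x') \<le> lpn q (\<lambda>n. of_real (1 - l) * u n) + lpn q (\<lambda>n. of_real l * g n)"
          using lpn_triangle[OF q0(2) lpc_scale[OF uw(1)] lpc_scale[OF g]] by simp
        also have "\<dots> = (1 - l) * lpn q u + l * lpn q g"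
          unfolding lpn_scale[OF q0(1) uw(1)] lpn_scale[OF q0(1) g] norm_of_real using l by simp
        also have "\<dots> \<le> (1 - l) * 1 + l * (1 + \<sigma> * G + 3 * e * s)"
          using l u1 gle by (intro add_mono mult_left_mono) auto
        also have "\<dots> = 1 + (l * \<sigma>) * G + 3 * e * (l * s)"
          by (simp add: algebra_simps)
        also have "\<dots> = 1 + t * G + 3 * e * \<bar>t\<bar>"
          by (simp only: l(3)[symmetric] l(4))
        finally have "lpn q (B x') \<le> 1 + t * G + 3 * e * \<bar>t\<bar>" .
        moreover have "lpn q (B x') = lpn q (B x)"
        proof -
          have xin: "x \<in> lpc p"
            using x by (simp add: unit_ball_lp_iff)
          show ?thesis
            unfolding x'_def op_scale[OF B xin] lpn_scale[OF q0(1) op_lpc[OF B xin]] by (simp add: \<alpha>)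
        qed
        ultimately show ?thesis
          by simp
      qed
    qed
    moreover have "0 \<le> e * \<bar>t\<bar>"
      using e by simp
    ultimately show ?thesis
      using lower unfolding B_def[symmetric] v_def[symmetric] G_def[symmetric] by linarith
  qed
  moreover have "0 < d"
    using s \<delta> by (simp add: d_def)
  ultimately show ?thesis
    by blast
qed

text \<open>The derivative at \<open>T\<close> is \<open>A \<mapsto> lq_gradient q (T z) (A z)\<close>, extended by \<open>0\<close> off the carrier as the
  dual space requires.\<close>

lemma frechet_if_unique_maximizer:
  assumes unique: "\<And>x1 x2. x1 \<in> unit_ball (lp p) \<Longrightarrow> x2 \<in> unit_ball (lp p) \<Longrightarrow>
      lpn q (T x1) = 1 \<Longrightarrow> lpn q (T x2) = 1 \<Longrightarrow> \<exists>\<alpha>. norm \<alpha> = 1 \<and> x1 = (\<lambda>n. \<alpha> * x2 n)"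
  shows "frechet_differentiable_norm (bops (lp p) (lp q)) T"
proof -
  have p0: "0 < p" "1 \<le> p" and q0: "0 < q" "1 \<le> q"
    using p q by auto
  obtain z where z: "z \<in> unit_ball (lp p)" "lpn q (T z) = 1"
    using norm_attained by blast
  then have z': "z \<in> lpc p"
    by (simp add: unit_ball_lp_iff)
  have Tz: "T z \<in> lpc q"
    by (rule op_lpc[OF T z'])
  define f where "f A = (if A \<in> opc p q then lq_gradient q (T z) (A z) else 0)" for A
  have "f \<in> vecs (dual (bops (lp p) (lp q)))"
  proof -
    have 1: "f (A + B) = f A + f B" if A: "A \<in> opc p q" and B: "B \<in> opc p q" for A B
    proof -
      have Az: "A z \<in> lpc q"
        by (rule op_lpc[OF A z'])
      have Bz: "B z \<in> lpc q"
        by (rule op_lpc[OF B z'])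
      have g: "lq_gradient q (T z) (A z + B z) = lq_gradient q (T z) (A z) + lq_gradient q (T z) (B z)"
        by (rule lq_gradient_add[OF q Tz Az Bz])
      have AB: "A + B \<in> opc p q"
        by (rule op_plus[OF p0(1) q0(2) A B])
      have "f (A + B) = lq_gradient q (T z) ((A + B) z)"
        unfolding f_def using AB by (rule if_P)
      also have "(A + B) z = A z + B z"
        by (rule plus_fun_apply)
      also have "lq_gradient q (T z) (A z + B z) = f A + f B"
        using A B g by (simp only: f_def if_True)
      finally show ?thesis .
    qed
    have 2: "f (\<lambda>x n. c * A x n) = c * f A" if "A \<in> opc p q" for A c
      using lq_gradient_scale[OF q Tz op_lpc[OF that z']]
      by (simp only: f_def op_scale_in[OF p0(1) q0(1) that] that if_True)
    have 3: "norm (f A) \<le> 2 * opn p q A" if "A \<in> opc p q" for A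
      using norm_lq_gradient_le[OF q Tz op_lpc[OF that z'] z(2)] opn_ball[OF that z(1)] that
      by (simp add: f_def)
    have 4: "f A = 0" if "A \<notin> opc p q" for A
      using that by (simp add: f_def)
    show ?thesis
      unfolding bops_def[of "bops (lp p) (lp q)"] scalars_def smul_bops nspace.simps mem_Collect_eq
      by (intro conjI ballI allI impI UNIV_I exI[of _ 2] 1 2 3 4)
  qed
  moreover have "uniform_limit (unit_ball (bops (lp p) (lp q)))
      (\<lambda>t A. (opn p q (T + smul (bops (lp p) (lp q)) (of_real t) A) - 1) / t) (\<lambda>A. f A \<bullet> 1) (at (0::real))"
  proof (rule uniform_limitI)
    fix e :: real
    assume e: "0 < e"
    have "0 < e / 6"
      using e by simp
    then obtain d where d: "0 < d" and exp: "\<And>A t. A \<in> opc p q \<Longrightarrow> opn p q A \<le> 1 \<Longrightarrow> \<bar>t\<bar> < d \<Longrightarrow>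
      \<bar>opn p q (T + (\<lambda>x n. of_real t * A x n)) - 1 - t * (lq_gradient q (T z) (A z) \<bullet> 1)\<bar> \<le> 3 * (e / 6) * \<bar>t\<bar>"
      using norm_expansion[OF unique z] by blast
    have "\<forall>\<^sub>F t in at (0::real). t \<noteq> 0 \<and> \<bar>t\<bar> < d"
      using d by (auto simp: eventually_at intro!: exI[of _ d])
    then show "\<forall>\<^sub>F t in at 0. \<forall>A\<in>unit_ball (bops (lp p) (lp q)).
        dist ((opn p q (T + smul (bops (lp p) (lp q)) (of_real t) A) - 1) / t) (f A \<bullet> 1) < e"
    proof eventually_elim
      case (elim t)
      show ?case
      proof
        fix A :: "(nat \<Rightarrow> 'a) \<Rightarrow> nat \<Rightarrow> 'a"
        assume "A \<in> unit_ball (bops (lp p) (lp q))"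
        then have A: "A \<in> opc p q" "opn p q A \<le> 1"
          by (auto simp: unit_ball_bops_iff)
        define N where "N = opn p q (T + (\<lambda>x n. of_real t * A x n))"
        have "\<bar>N - 1 - t * (f A \<bullet> 1)\<bar> \<le> e / 2 * \<bar>t\<bar>"
          using exp[OF A, of t] elim A by (simp add: f_def N_def)
        moreover have "(N - 1) / t - f A \<bullet> 1 = (N - 1 - t * (f A \<bullet> 1)) / t"
          using elim by (simp add: field_simps)
        ultimately have "\<bar>(N - 1) / t - f A \<bullet> 1\<bar> \<le> e / 2"
          using elim by (simp add: pos_divide_le_eq)
        then show "dist ((opn p q (T + smul (bops (lp p) (lp q)) (of_real t) A) - 1) / t) (f A \<bullet> 1) < e"
          using e by (simp add: dist_real_def N_def)
      qed
    qed
  qed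
  ultimately show ?thesis
    using T T1 unfolding frechet_differentiable_norm_def unit_sphere_def by blast
qed

end

lemma gateaux_if_frechet:
  assumes "frechet_differentiable_norm X u"
  shows "gateaux_differentiable_norm X u"
  using assms unfolding frechet_differentiable_norm_def gateaux_differentiable_norm_def
  by (auto dest: tendsto_uniform_limitI)

section \<open>The characterization\<close>

theorem norm_differentiable_iff:
  fixes T :: "(nat \<Rightarrow> 'a::{real_normed_field, euclidean_space}) \<Rightarrow> nat \<Rightarrow> 'a"
  assumes p: "1 < p" and q: "1 < q" and T: "T \<in> opc p q \<and> opn p q T = 1"
  shows "(frechet_differentiable_norm (bops (lp p) (lp q)) T \<longleftrightarrow>
           ess_norm (lp p) (lp q) T < 1 \<and>
           (\<forall>x1\<in>unit_ball (lp p). \<forall>x2\<in>unit_ball (lp p).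
              nrm (lp q) (T x1) = 1 \<and> nrm (lp q) (T x2) = 1 \<longrightarrow>
              (\<exists>\<alpha>. norm \<alpha> = 1 \<and> x1 = smul (lp p) \<alpha> x2))) \<and>
        (frechet_differentiable_norm (bops (lp p) (lp q)) T \<longleftrightarrow>
           gateaux_differentiable_norm (bops (lp p) (lp q)) T)"
    (is "(?F \<longleftrightarrow> ?ess \<and> ?uniq) \<and> (?F \<longleftrightarrow> ?G)")
proof -
  have "?G \<Longrightarrow> ?ess"
    using gateaux_imp_ess_norm_less_1[of p q T] p q T by simp
  moreover have ?uniq if ?G
    unfolding smul_lp using gateaux_imp_unique_maximizer[of p q T] p q T that
    by (metis less_imp_le)
  moreover have "?ess \<and> ?uniq \<Longrightarrow> ?F"
    using frechet_if_unique_maximizer[OF p q] T unfolding smul_lp by blast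
  moreover have "?F \<Longrightarrow> ?G"
    by (rule gateaux_if_frechet)
  ultimately show ?thesis
    by blast
qed

theorem proposition3p11:
  fixes p q :: real
  assumes "1 < p" and "1 < q"
  shows
    "(\<forall>T :: (nat \<Rightarrow> real) \<Rightarrow> nat \<Rightarrow> real.
        T \<in> vecs (bops (lp p) (lp q)) \<and> nrm (bops (lp p) (lp q)) T = 1 \<longrightarrow>
        (frechet_differentiable_norm (bops (lp p) (lp q)) T \<longleftrightarrow>
           ess_norm (lp p) (lp q) T < 1 \<and>
           (\<forall>x1\<in>unit_ball (lp p). \<forall>x2\<in>unit_ball (lp p).
              nrm (lp q) (T x1) = 1 \<and> nrm (lp q) (T x2) = 1 \<longrightarrow>
              (\<exists>\<alpha>. norm \<alpha> = 1 \<and> x1 = smul (lp p) \<alpha> x2))) \<and>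
        (frechet_differentiable_norm (bops (lp p) (lp q)) T \<longleftrightarrow>
           gateaux_differentiable_norm (bops (lp p) (lp q)) T)) \<and>
     (\<forall>T :: (nat \<Rightarrow> complex) \<Rightarrow> nat \<Rightarrow> complex.
        T \<in> vecs (bops (lp p) (lp q)) \<and> nrm (bops (lp p) (lp q)) T = 1 \<longrightarrow>
        (frechet_differentiable_norm (bops (lp p) (lp q)) T \<longleftrightarrow>
           ess_norm (lp p) (lp q) T < 1 \<and>
           (\<forall>x1\<in>unit_ball (lp p). \<forall>x2\<in>unit_ball (lp p).
              nrm (lp q) (T x1) = 1 \<and> nrm (lp q) (T x2) = 1 \<longrightarrow>
              (\<exists>\<alpha>. norm \<alpha> = 1 \<and> x1 = smul (lp p) \<alpha> x2))) \<and>
        (frechet_differentiable_norm (bops (lp p) (lp q)) T \<longleftrightarrow>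
           gateaux_differentiable_norm (bops (lp p) (lp q)) T))"
  by (rule conjI; rule allI, rule impI, rule norm_differentiable_iff[OF assms])

end
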